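(* Let $\tilde{\mathcal H}_{n,2d}$ denote the vector space of real polynomials in $n$ variables of degree at most $2d$ ($d\ge1$), and let $f\in\tilde{\mathcal H}_{n,2d}$. Consider the optimization problem $$\min_{g\in\tilde{\mathcal H}_{n,2d}}\ \frac1{\mathcal A_n}\int_{S^{n-1}}\mathrm{Tr}\,H_g\,d\sigma\quad\text{subject to } g\text{ convex},\ g-f\text{ convex},$$ where $\mathcal A_n=\frac{2\pi^{n/2}}{\Gamma(n/2)}$. Then an optimal solution to this problem exists, and any optimal solution is an undominated dcd of $f$.
   Context: $S^{n-1}$ is the unit sphere in $\mathbb{R}^n$, $\sigma$ is the rotation-invariant measure on $S^{n-1}$ ($\mathcal A_n$ is a positive normalization constant, the area of $S^{n-1}$), $H_g$ is the Hessian of $g$, and $\Gamma$ is the gamma function. A polynomial $g$ is a dcd (difference of convex decomposition) of a polynomial $f$ if $g$ is convex and $g-f$ is convex. A dcd $g'$ of $f$ dominates a dcd $g$ of $f$ if $g-g'$ is convex and nonaffine. A dcd $g$ of $f$ is undominated if no dcd of $f$ dominates $g$.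
   Formalization: The case n = 1 with d ≥ 3 is excluded: there the claim fails for every f, since adding a convex h with h'' = (x²−1)² to any optimal g gives another optimal solution, which g dominates (e.g. f = 0, g = 0). *)

theory Defs
  imports "HOL-Analysis.Analysis"
begin

text \<open>Polynomials are represented by the functions they induce, which loses nothing over the
  reals. A monomial is given by its exponent vector \<open>\<alpha> :: 'n \<Rightarrow> nat\<close>.\<close>

definition polys_deg_le :: "nat \<Rightarrow> (real^'n \<Rightarrow> real) set" where
  "polys_deg_le k =
     {p. \<exists>c :: ('n \<Rightarrow> nat) \<Rightarrow> real.
           p = (\<lambda>x. \<Sum>\<alpha> | (\<Sum>i\<in>UNIV. \<alpha> i) \<le> k. c \<alpha> * (\<Prod>i\<in>UNIV. (x $ i) ^ \<alpha> i))}"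

definition hessian :: "(real^'n \<Rightarrow> real) \<Rightarrow> real^'n \<Rightarrow> real^'n^'n" where
  "hessian g x =
     (\<chi> i j. frechet_derivative (\<lambda>y. frechet_derivative g (at y) (axis j 1)) (at x) (axis i 1))"

text \<open>The surface measure of the unit sphere, as the cone measure
  \<open>A \<mapsto> n \<cdot> vol {t x | x \<in> A, 0 < t \<le> 1}\<close>. The lemmas below show that its total mass is the area
  of the sphere and that it is invariant under orthogonal transformations. In dimension one it is
  the counting measure on the two points of the sphere.\<close>

definition sphere_measure :: "(real^'n) measure" where
  "sphere_measure =
     scale_measure (of_nat CARD('n))
       (distr (restrict_space lborel (cball 0 1 - {0}))
              (restrict_space borel (sphere 0 1))
              (\<lambda>x. x /\<^sub>R norm x))"

definition sphere_area :: "nat \<Rightarrow> real" where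
  "sphere_area n = 2 * pi powr (real n / 2) / Gamma (real n / 2)"

definition mean_trace_hessian :: "(real^'n \<Rightarrow> real) \<Rightarrow> real" where
  "mean_trace_hessian g =
     1 / sphere_area CARD('n) * (LINT x|sphere_measure. trace (hessian g x))"

text \<open>On the line the sphere is the pair \<open>{1, -1}\<close>, and from degree \<open>6\<close> on this objective does not
  separate convex polynomials from affine ones: for \<open>f = 0\<close>, the convex \<open>g\<close> with
  \<open>g'' x = (x\<^sup>2 - 1)\<^sup>2\<close> attains the minimum \<open>0\<close> but is dominated by \<open>0\<close>; and for
  \<open>f'' x = x - 1\<close> the infimum \<open>0\<close> is not attained. Both existence and undominatedness of minimizers
  thus need dimension \<open>\<ge> 2\<close> or \<open>d \<le> 2\<close>.\<close>

definition feasible :: "nat \<Rightarrow> (real^'n \<Rightarrow> real) \<Rightarrow> (real^'n \<Rightarrow> real) \<Rightarrow> bool" where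
  "feasible d f g \<longleftrightarrow>
     g \<in> polys_deg_le (2 * d) \<and> convex_on UNIV g \<and> convex_on UNIV (\<lambda>x. g x - f x)"

definition affine_fun :: "(real^'n \<Rightarrow> real) \<Rightarrow> bool" where
  "affine_fun h \<longleftrightarrow> (\<exists>a b. \<forall>x. h x = a \<bullet> x + b)"

definition dcd :: "(real^'n \<Rightarrow> real) \<Rightarrow> (real^'n \<Rightarrow> real) \<Rightarrow> bool" where
  "dcd f g \<longleftrightarrow>
     real_polynomial_function g \<and> convex_on UNIV g \<and> convex_on UNIV (\<lambda>x. g x - f x)"

definition dominates :: "(real^'n \<Rightarrow> real) \<Rightarrow> (real^'n \<Rightarrow> real) \<Rightarrow> (real^'n \<Rightarrow> real) \<Rightarrow> bool" where
  "dominates f g' g \<longleftrightarrow>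
     dcd f g' \<and> dcd f g \<and>
     convex_on UNIV (\<lambda>x. g x - g' x) \<and> \<not> affine_fun (\<lambda>x. g x - g' x)"

text \<open>A dominating decomposition may have any degree.\<close>

definition undominated_dcd :: "(real^'n \<Rightarrow> real) \<Rightarrow> (real^'n \<Rightarrow> real) \<Rightarrow> bool" where
  "undominated_dcd f g \<longleftrightarrow> dcd f g \<and> \<not> (\<exists>g'. dominates f g' g)"

lemma finite_exponents: "finite {\<alpha> :: 'n::finite \<Rightarrow> nat. (\<Sum>i\<in>UNIV. \<alpha> i) \<le> k}"
proof (rule finite_subset)
  show "{\<alpha> :: 'n \<Rightarrow> nat. (\<Sum>i\<in>UNIV. \<alpha> i) \<le> k} \<subseteq> PiE UNIV (\<lambda>_. {..k})"
  proof
    fix \<alpha> :: "'n \<Rightarrow> nat" assume "\<alpha> \<in> {\<alpha>. (\<Sum>i\<in>UNIV. \<alpha> i) \<le> k}"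
    then have "\<alpha> i \<le> k" for i
      using member_le_sum[of i UNIV \<alpha>] by (simp add: order_trans)
    then show "\<alpha> \<in> PiE UNIV (\<lambda>_. {..k})"
      by auto
  qed
  show "finite (PiE (UNIV :: 'n set) (\<lambda>_. {..k}))"
    by (intro finite_PiE) auto
qed

lemma polys_deg_le_monomial:
  fixes \<alpha> :: "'n::finite \<Rightarrow> nat"
  assumes "(\<Sum>i\<in>UNIV. \<alpha> i) \<le> k"
  shows "(\<lambda>x :: real^'n. b * (\<Prod>i\<in>UNIV. (x $ i) ^ \<alpha> i)) \<in> polys_deg_le k"
  unfolding polys_deg_le_def mem_Collect_eq
proof (intro exI ext)
  fix x :: "real^'n"
  show "b * (\<Prod>i\<in>UNIV. (x $ i) ^ \<alpha> i) =
      (\<Sum>\<beta> | (\<Sum>i\<in>UNIV. \<beta> i) \<le> k. (if \<beta> = \<alpha> then b else 0) * (\<Prod>i\<in>UNIV. (x $ i) ^ \<beta> i))"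
    using assms by (simp add: if_distrib[of "\<lambda>t. t * _"] sum.delta'[OF finite_exponents]
        sum.delta[OF finite_exponents] cong: if_cong)
qed

lemma polys_deg_le_add:
  assumes "p \<in> polys_deg_le k" "q \<in> polys_deg_le k"
  shows "(\<lambda>x. p x + q x) \<in> polys_deg_le k"
proof -
  from assms obtain c e where
    "p = (\<lambda>x. \<Sum>\<alpha> | (\<Sum>i\<in>UNIV. \<alpha> i) \<le> k. c \<alpha> * (\<Prod>i\<in>UNIV. (x $ i) ^ \<alpha> i))"
    "q = (\<lambda>x. \<Sum>\<alpha> | (\<Sum>i\<in>UNIV. \<alpha> i) \<le> k. e \<alpha> * (\<Prod>i\<in>UNIV. (x $ i) ^ \<alpha> i))"
    unfolding polys_deg_le_def by blast
  then show ?thesis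
    unfolding polys_deg_le_def
    by (auto simp: sum.distrib distrib_right intro!: exI[of _ "\<lambda>\<alpha>. c \<alpha> + e \<alpha>"])
qed

lemma polys_deg_le_sum:
  assumes "finite A" "\<And>a. a \<in> A \<Longrightarrow> p a \<in> polys_deg_le k"
  shows "(\<lambda>x. \<Sum>a\<in>A. p a x) \<in> polys_deg_le k"
  using assms
proof (induction A rule: finite_induct)
  case empty
  show ?case
    using polys_deg_le_monomial[of "\<lambda>_. 0" k 0] by simp
next
  case (insert a A)
  then show ?case
    using polys_deg_le_add[of "p a" k "\<lambda>x. \<Sum>a\<in>A. p a x"] by simp
qed

lemma polys_deg_le_mono:
  assumes "p \<in> polys_deg_le k" "k \<le> l"
  shows "p \<in> polys_deg_le l"
proof -
  from assms obtain c where
    "p = (\<lambda>x. \<Sum>\<alpha> | (\<Sum>i\<in>UNIV. \<alpha> i) \<le> k. c \<alpha> * (\<Prod>i\<in>UNIV. (x $ i) ^ \<alpha> i))"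
    unfolding polys_deg_le_def by blast
  with assms(2) show ?thesis
    by (auto intro!: polys_deg_le_sum finite_exponents polys_deg_le_monomial)
qed

lemma polys_deg_le_mult:
  fixes p q :: "real^'n \<Rightarrow> real"
  assumes "p \<in> polys_deg_le k" "q \<in> polys_deg_le l"
  shows "(\<lambda>x. p x * q x) \<in> polys_deg_le (k + l)"
proof -
  from assms obtain c e where
    p: "p = (\<lambda>x. \<Sum>\<alpha> | (\<Sum>i\<in>UNIV. \<alpha> i) \<le> k. c \<alpha> * (\<Prod>i\<in>UNIV. (x $ i) ^ \<alpha> i))" and
    q: "q = (\<lambda>x. \<Sum>\<alpha> | (\<Sum>i\<in>UNIV. \<alpha> i) \<le> l. e \<alpha> * (\<Prod>i\<in>UNIV. (x $ i) ^ \<alpha> i))"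
    unfolding polys_deg_le_def by blast
  have eq: "(\<lambda>x. p x * q x) = (\<lambda>x. \<Sum>\<alpha> | (\<Sum>i\<in>UNIV. \<alpha> i) \<le> k. \<Sum>\<beta> | (\<Sum>i\<in>UNIV. \<beta> i) \<le> l.
      c \<alpha> * e \<beta> * (\<Prod>i\<in>UNIV. (x $ i) ^ (\<alpha> i + \<beta> i)))"
    unfolding p q by (simp add: sum_product power_add prod.distrib mult_ac)
  show ?thesis
    unfolding eq
    by (intro polys_deg_le_sum finite_exponents polys_deg_le_monomial)
       (auto simp: sum.distrib intro: add_mono)
qed

lemma real_polynomial_function_iff_polys_deg_le:
  fixes p :: "real^'n \<Rightarrow> real"
  shows "real_polynomial_function p \<longleftrightarrow> (\<exists>k. p \<in> polys_deg_le k)"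
proof
  assume "real_polynomial_function p"
  then show "\<exists>k. p \<in> polys_deg_le k"
  proof (induction p rule: real_polynomial_function.induct)
    case (linear h)
    then interpret bounded_linear h .
    have coord: "(\<lambda>x :: real^'n. b * x $ i) \<in> polys_deg_le 1" for b i
    proof -
      have "(\<Prod>j\<in>UNIV. (x $ j) ^ (if j = i then 1 else 0)) = x $ i" for x :: "real^'n"
        by (simp add: if_distrib[of "\<lambda>t. _ ^ t"] cong: if_cong)
      then show ?thesis
        using polys_deg_le_monomial[of "\<lambda>j. if j = i then 1 else 0" 1 b] by simp
    qed
    have "h = (\<lambda>x. \<Sum>i\<in>UNIV. h (axis i 1) * x $ i)"
    proof
      fix x
      have "h x = h (\<Sum>i\<in>UNIV. x $ i *\<^sub>R axis i 1)"
        using basis_expansion[of x] by (simp add: scalar_mult_eq_scaleR)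
      then show "h x = (\<Sum>i\<in>UNIV. h (axis i 1) * x $ i)"
        by (simp add: sum scaleR mult.commute)
    qed
    also have "\<dots> \<in> polys_deg_le 1"
      by (intro polys_deg_le_sum coord) auto
    finally show ?case by blast
  next
    case (const c)
    show ?case
      using polys_deg_le_monomial[of "\<lambda>_. 0" 0 c] by auto
  next
    case (add p q)
    then obtain k l where "p \<in> polys_deg_le k" "q \<in> polys_deg_le l" by blast
    then have "p \<in> polys_deg_le (k + l)" "q \<in> polys_deg_le (k + l)"
      by (auto elim: polys_deg_le_mono)
    then show ?case
      by (blast intro: polys_deg_le_add)
  next
    case (mult p q)
    then show ?case
      using polys_deg_le_mult by blast
  qed
next
  assume "\<exists>k. p \<in> polys_deg_le k"
  then obtain k c where
    p: "p = (\<lambda>x. \<Sum>\<alpha> | (\<Sum>i\<in>UNIV. \<alpha> i) \<le> k. c \<alpha> * (\<Prod>i\<in>UNIV. (x $ i) ^ \<alpha> i))"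
    unfolding polys_deg_le_def by blast
  have "real_polynomial_function (\<lambda>x :: real^'n. x $ i)" for i
    by (intro real_polynomial_function.intros(1) bounded_linear_vec_nth)
  then show "real_polynomial_function p"
    unfolding p
    by (intro real_polynomial_function_sum finite_exponents real_polynomial_function.intros(4)
        real_polynomial_function.intros(2) real_polynomial_function_prod
        real_polynomial_function_power) auto
qed

lemma space_sphere_measure [simp]: "space (sphere_measure :: (real^'n) measure) = sphere 0 1"
  by (simp add: sphere_measure_def space_scale_measure space_restrict_space)

lemma sets_sphere_measure [simp]:
  "sets (sphere_measure :: (real^'n) measure) = sets (restrict_space borel (sphere 0 1))"
  by (simp add: sphere_measure_def)

lemma emeasure_sphere_measure:
  fixes A :: "(real^'n) set"
  assumes "A \<in> sets borel" "A \<subseteq> sphere 0 1"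
  shows "emeasure sphere_measure A =
    of_nat CARD('n) * emeasure lborel {x \<in> cball 0 1 - {0}. x /\<^sub>R norm x \<in> A}"
proof -
  have [measurable]: "(\<lambda>x :: real^'n. x /\<^sub>R norm x)
      \<in> restrict_space lborel (cball 0 1 - {0}) \<rightarrow>\<^sub>M restrict_space borel (sphere 0 1)"
    by (intro measurable_restrict_space3 borel_measurable_scaleR borel_measurable_inverse
        measurable_compose[OF _ borel_measurable_norm]) auto
  have "A \<in> sets (restrict_space borel (sphere 0 1))"
    using assms by (auto simp: sets_restrict_space)
  then have "emeasure sphere_measure A = of_nat CARD('n) *
      emeasure (restrict_space lborel (cball 0 1 - {0}))
        ((\<lambda>x. x /\<^sub>R norm x) -` A \<inter> space (restrict_space lborel (cball 0 1 - {0})))"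
    by (simp add: sphere_measure_def emeasure_distr)
  also have "(\<lambda>x. x /\<^sub>R norm x) -` A \<inter> space (restrict_space lborel (cball 0 1 - {0}))
      = {x \<in> cball 0 1 - {0}. x /\<^sub>R norm x \<in> A}"
    by (auto simp: space_restrict_space)
  also have "emeasure (restrict_space lborel (cball 0 1 - {0})) \<dots> = emeasure lborel \<dots>"
    by (intro emeasure_restrict_space) auto
  finally show ?thesis .
qed

lemma emeasure_sphere_measure_total:
  "emeasure (sphere_measure :: (real^'n) measure) (sphere 0 1) = ennreal (sphere_area CARD('n))"
proof -
  let ?n = "real CARD('n)"
  have "{x :: real^'n \<in> cball 0 1 - {0}. x /\<^sub>R norm x \<in> sphere 0 1} = cball 0 1 - {0}"
    by auto
  moreover have "emeasure lborel (cball (0 :: real^'n) 1 - {0}) = ennreal (unit_ball_vol ?n)"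
    by (subst emeasure_Diff) (auto simp: emeasure_cball)
  ultimately have "emeasure (sphere_measure :: (real^'n) measure) (sphere 0 1)
      = ennreal (?n * unit_ball_vol ?n)"
    by (subst emeasure_sphere_measure) (auto simp: ennreal_mult ennreal_of_nat_eq_real_of_nat)
  also have "?n * unit_ball_vol ?n = sphere_area CARD('n)"
  proof -
    have "?n / 2 \<notin> \<int>\<^sub>\<le>\<^sub>0"
      by (metis half_gt_zero nonpos_Ints_nonpos not_le of_nat_0_less_iff zero_less_card_finite)
    then have Gamma: "Gamma (?n / 2 + 1) = ?n / 2 * Gamma (?n / 2)"
      by (rule Gamma_plus1)
    show ?thesis
      unfolding unit_ball_vol_def sphere_area_def Gamma by simp
  qed
  finally show ?thesis .
qed

lemma emeasure_lborel_orthogonal_vimage: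
  fixes T :: "'a :: euclidean_space \<Rightarrow> 'a"
  assumes "orthogonal_transformation T" "A \<in> sets borel"
  shows "emeasure lborel (T -` A) = emeasure lborel A"
proof -
  have lin: "linear T" and norm: "\<And>x. norm (T x) = norm x" and bij: "bij T"
    using assms(1) by (auto simp: orthogonal_transformation orthogonal_transformation_bij)
  define S where "S = inv T"
  have TS: "T (S x) = x" for x
    unfolding S_def using bij by (simp add: bij_is_surj surj_f_inv_f)
  have [measurable]: "T \<in> borel_measurable borel"
    using lin by (intro borel_measurable_continuous_onI linear_continuous_on)
      (simp add: linear_conv_bounded_linear)
  note [measurable] = assms(2)
  let ?B = "ball (0 :: 'a) 1"
  have [measurable, simp]: "(indicator ?B :: 'a \<Rightarrow> ennreal) \<in> borel_measurable borel"
    by (intro borel_measurable_indicator) simp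
  have shift: "(\<integral>\<^sup>+x. h (c + x) \<partial>lborel) = (\<integral>\<^sup>+x. h x \<partial>lborel)"
    if "h \<in> borel_measurable borel" for h :: "'a \<Rightarrow> ennreal" and c
    using that by (subst (2) lborel_distr_plus[of c, symmetric]) (subst nn_integral_distr; simp)
  have "emeasure lborel ?B * emeasure lborel (T -` A)
      = (\<integral>\<^sup>+y. indicator ?B y * emeasure lborel (T -` A) \<partial>lborel)"
    by (subst nn_integral_multc) auto
  also have "\<dots> = (\<integral>\<^sup>+y. \<integral>\<^sup>+x. indicator ?B y * indicator A (y + T x) \<partial>lborel \<partial>lborel)"
  proof (rule nn_integral_cong)
    fix y :: 'a
    have "emeasure lborel (T -` A) = (\<integral>\<^sup>+x. indicator A (T x) \<partial>lborel)"
    proof -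
      have "T -` A \<in> sets lborel"
        using measurable_sets[of T borel borel A] by simp
      from nn_integral_indicator[OF this] show ?thesis
        by (simp add: indicator_def)
    qed
    also have "\<dots> = (\<integral>\<^sup>+x. indicator A (T (S y + x)) \<partial>lborel)"
      by (rule shift[symmetric]) measurable
    also have "\<dots> = (\<integral>\<^sup>+x. indicator A (y + T x) \<partial>lborel)"
      using lin by (simp add: linear_add TS)
    finally have "indicator ?B y * emeasure lborel (T -` A)
        = indicator ?B y * (\<integral>\<^sup>+x. indicator A (y + T x) \<partial>lborel)"
      by simp
    also have "\<dots> = (\<integral>\<^sup>+x. indicator ?B y * indicator A (y + T x) \<partial>lborel)"
      by (rule nn_integral_cmult[symmetric]) measurable
    finally show "indicator ?B y * emeasure lborel (T -` A)
        = (\<integral>\<^sup>+x. indicator ?B y * indicator A (y + T x) \<partial>lborel)" .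
  qed
  also have "\<dots> = (\<integral>\<^sup>+x. \<integral>\<^sup>+y. indicator ?B y * indicator A (y + T x) \<partial>lborel \<partial>lborel)"
    by (rule lborel_pair.Fubini') measurable
  also have "\<dots> = (\<integral>\<^sup>+x. \<integral>\<^sup>+y. indicator ?B (y - T x) * indicator A y \<partial>lborel \<partial>lborel)"
  proof (rule nn_integral_cong)
    fix x :: 'a
    have "(\<integral>\<^sup>+y. indicator ?B (y - T x) * indicator A y \<partial>lborel)
        = (\<integral>\<^sup>+y. indicator ?B ((T x + y) - T x) * indicator A (T x + y) \<partial>lborel)"
      by (rule shift[symmetric]) measurable
    then show "(\<integral>\<^sup>+y. indicator ?B y * indicator A (y + T x) \<partial>lborel)
        = (\<integral>\<^sup>+y. indicator ?B (y - T x) * indicator A y \<partial>lborel)"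
      by (simp add: add.commute)
  qed
  also have "\<dots> = (\<integral>\<^sup>+y. \<integral>\<^sup>+x. indicator ?B (y - T x) * indicator A y \<partial>lborel \<partial>lborel)"
    by (rule lborel_pair.Fubini') measurable
  also have "\<dots> = (\<integral>\<^sup>+y. emeasure lborel ?B * indicator A y \<partial>lborel)"
  proof (rule nn_integral_cong)
    fix y :: 'a
    have "norm (y - T x) = dist (S y) x" for x
      using norm[of "S y - x"] lin by (simp add: linear_diff TS dist_norm)
    then have "(\<integral>\<^sup>+x. indicator ?B (y - T x) \<partial>lborel) = (\<integral>\<^sup>+x. indicator (ball (S y) 1) x \<partial>lborel)"
      by (intro nn_integral_cong) (auto simp: indicator_def)
    also have "\<dots> = emeasure lborel ?B"
      by (simp add: emeasure_ball)
    finally show "(\<integral>\<^sup>+x. indicator ?B (y - T x) * indicator A y \<partial>lborel)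
        = emeasure lborel ?B * indicator A y"
      by (subst nn_integral_multc) auto
  qed
  also have "\<dots> = emeasure lborel ?B * emeasure lborel A"
    by (subst nn_integral_cmult) auto
  finally show ?thesis
    using less_imp_neq[OF unit_ball_vol_pos[of "real DIM('a)"]]
    by (auto simp: emeasure_ball ennreal_mult_cancel_left)
qed

lemma sphere_measure_orthogonal_image:
  fixes T :: "real^'n \<Rightarrow> real^'n"
  assumes "orthogonal_transformation T" "A \<in> sets borel" "A \<subseteq> sphere 0 1"
  shows "emeasure sphere_measure (T ` A) = emeasure sphere_measure A"
proof -
  let ?C = "\<lambda>A. {x :: real^'n \<in> cball 0 1 - {0}. x /\<^sub>R norm x \<in> A}"
  have lin: "linear T" and norm: "\<And>x. norm (T x) = norm x" and "bij T"
    using assms(1) by (auto simp: orthogonal_transformation orthogonal_transformation_bij)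
  obtain S where S: "orthogonal_transformation S" "\<And>x. S (T x) = x" "\<And>x. T (S x) = x"
    using assms(1) orthogonal_transformation_inv[OF assms(1)] \<open>bij T\<close>
    by (metis bij_inv_eq_iff)
  have TA: "T ` A = S -` A"
    using S by (auto simp: image_iff) metis
  have "S \<in> borel_measurable borel"
    using S(1) by (intro borel_measurable_continuous_onI linear_continuous_on)
      (auto simp: orthogonal_transformation linear_conv_bounded_linear)
  from measurable_sets[OF this assms(2)] have TAb: "T ` A \<in> sets borel"
    by (simp add: TA)
  have meas: "?C B \<in> sets borel" if "B \<in> sets borel" for B
  proof -
    have "(\<lambda>x :: real^'n. x /\<^sub>R norm x) \<in> borel_measurable borel"
      by measurable
    from measurable_sets[OF this that]
    have "(cball 0 1 - {0}) \<inter> ((\<lambda>x. x /\<^sub>R norm x) -` B) \<in> sets borel"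
      by auto
    also have "(cball 0 1 - {0}) \<inter> ((\<lambda>x. x /\<^sub>R norm x) -` B) = ?C B"
      by auto
    finally show ?thesis .
  qed
  have norm_S: "norm (S x) = norm x" for x
    using norm[of "S x"] S(3)[of x] by metis
  have "?C (T ` A) = S -` ?C A"
  proof (intro set_eqI)
    fix x
    have "S (x /\<^sub>R norm x) = S x /\<^sub>R norm (S x)"
      using S(1) by (simp add: orthogonal_transformation linear_scale norm_S)
    moreover have "S x = 0 \<longleftrightarrow> x = 0"
      using norm_S norm_eq_zero by metis
    ultimately show "x \<in> ?C (T ` A) \<longleftrightarrow> x \<in> S -` ?C A"
      by (simp add: TA norm_S)
  qed
  then have "emeasure lborel (?C (T ` A)) = emeasure lborel (?C A)"
    using emeasure_lborel_orthogonal_vimage[OF S(1) meas[OF assms(2)]] by simp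
  moreover have "T ` A \<subseteq> sphere 0 1"
    using assms(3) norm by auto
  ultimately show ?thesis
    using assms TAb by (simp add: emeasure_sphere_measure)
qed

end

theory Submission
  imports Defs
begin

text \<open>Write \<open>J\<close> for the objective, the mean over the sphere of the trace of the Hessian. It is
linear, it vanishes on affine functions, and it is nonnegative on convex polynomials. Everything
rests on one rigidity fact (\<open>affine_if_mean_trace_hessian_eq_0\<close>): a convex polynomial \<open>h\<close> of degree
at most \<open>2d\<close> with \<open>J h = 0\<close> is affine. The trace of its Hessian is continuous and nonnegative, so it
vanishes on the sphere, and with it the whole positive semidefinite Hessian. In dimension at least
two the sphere is connected, so the gradient of \<open>h\<close> is constant on it; after subtracting a linear
function every point of the sphere is a minimizer of \<open>h\<close>, hence \<open>h\<close> is constant on the ball, and a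
polynomial constant on a ball is constant. In dimension one and degree at most four, \<open>h''\<close> is a
nonnegative quadratic with the two zeros \<open>1\<close> and \<open>-1\<close>, which forces \<open>h'' = 0\<close>.

An optimum exists. The feasible set is nonempty since, by polarization, every polynomial of degree at
most \<open>2d\<close> is a linear combination of \<open>2d\<close>-th powers of affine forms, which are convex
(\<open>feasible_exists\<close>). Polynomials modulo affine functions are given by coefficient vectors for
finitely many monomials that are linearly independent modulo affine functions. On the closed cone of
the vectors whose polynomial is convex, rigidity makes \<open>J\<close> positive away from \<open>0\<close>, so compactness of
the unit sphere of the cone gives \<open>J \<ge> \<epsilon> * norm\<close> with \<open>\<epsilon> > 0\<close>. Sublevel sets of \<open>J\<close> in the feasible
set are therefore compact, and the continuous \<open>J\<close> attains its minimum (\<open>optimal_exists\<close>).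

An optimum is undominated. Let \<open>g'\<close> dominate an optimal \<open>g\<close>. Both \<open>g'\<close> and \<open>g - g'\<close> are convex, so
both lie above their tangents at \<open>0\<close>, which traps \<open>g'\<close> between an affine function and \<open>g\<close> minus an
affine function. Hence \<open>g'\<close> grows along rays no faster than a polynomial of degree \<open>2d\<close> and has
degree at most \<open>2d\<close> (\<open>polys_deg_le_if_convex_summand\<close>). So \<open>g'\<close> is feasible, optimality gives
\<open>J (g - g') \<le> 0\<close>, and rigidity makes \<open>g - g'\<close> affine, which domination excludes.\<close>

section \<open>Directional derivatives of polynomials\<close>

definition dir_deriv :: "real^'n \<Rightarrow> (real^'n \<Rightarrow> real) \<Rightarrow> real^'n \<Rightarrow> real" where
  "dir_deriv v g x = frechet_derivative g (at x) v"

lemma dir_deriv_eqI: "(g has_derivative g') (at x) \<Longrightarrow> dir_deriv v g x = g' v"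
  unfolding dir_deriv_def by (metis frechet_derivative_at)

lemma has_derivative_dir_deriv:
  "real_polynomial_function g \<Longrightarrow> (g has_derivative (\<lambda>v. dir_deriv v g x)) (at x)"
  unfolding dir_deriv_def
  using differentiable_at_real_polynomial_function frechet_derivative_works by blast

lemma dir_deriv_linear:
  assumes "bounded_linear h" shows "dir_deriv v h = (\<lambda>x. h v)"
  by (rule ext, rule dir_deriv_eqI, rule bounded_linear_imp_has_derivative[OF assms])

lemma dir_deriv_const: "dir_deriv v (\<lambda>x. c) = (\<lambda>x. 0)"
  by (rule ext, subst dir_deriv_eqI[OF has_derivative_const]) simp

lemma dir_deriv_add:
  assumes "real_polynomial_function p" "real_polynomial_function q"
  shows "dir_deriv v (\<lambda>x. p x + q x) = (\<lambda>x. dir_deriv v p x + dir_deriv v q x)"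
  by (rule ext, rule dir_deriv_eqI)
     (rule has_derivative_add[OF assms[THEN has_derivative_dir_deriv]])

lemma dir_deriv_mult:
  assumes "real_polynomial_function p" "real_polynomial_function q"
  shows "dir_deriv v (\<lambda>x. p x * q x) = (\<lambda>x. p x * dir_deriv v q x + dir_deriv v p x * q x)"
  by (rule ext, rule dir_deriv_eqI)
     (rule has_derivative_mult[OF assms[THEN has_derivative_dir_deriv]])

lemma dir_deriv_cmult:
  assumes "real_polynomial_function p"
  shows "dir_deriv v (\<lambda>x. c * p x) = (\<lambda>x. c * dir_deriv v p x)"
  by (subst dir_deriv_mult) (auto simp: assms dir_deriv_const intro: real_polynomial_function.intros)

lemma real_polynomial_function_dir_deriv:
  assumes "real_polynomial_function p"
  shows "real_polynomial_function (dir_deriv v p)"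
  using assms
  by induction (auto simp: dir_deriv_linear dir_deriv_const dir_deriv_add dir_deriv_mult)

lemma bounded_linear_dir_deriv:
  assumes "real_polynomial_function p"
  shows "bounded_linear (\<lambda>v. dir_deriv v p x)"
  using has_derivative_dir_deriv[OF assms] by (rule has_derivative_bounded_linear)

lemma dir_deriv_scaleR:
  assumes "real_polynomial_function p"
  shows "dir_deriv (s *\<^sub>R v) p x = s * dir_deriv v p x"
  using linear_scale[OF bounded_linear.linear[OF bounded_linear_dir_deriv[OF assms]]] by simp

text \<open>Symmetry of the second derivative, which for polynomials is an induction with the product rule.\<close>

lemma dir_deriv_commute:
  assumes "real_polynomial_function p"
  shows "dir_deriv v (dir_deriv w p) = dir_deriv w (dir_deriv v p)"
  using assms
proof induction
  case (mult p q)
  then show ?case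
    by (simp add: dir_deriv_mult dir_deriv_add real_polynomial_function_dir_deriv
        real_polynomial_function.intros algebra_simps)
qed (simp_all add: dir_deriv_linear dir_deriv_const dir_deriv_add real_polynomial_function_dir_deriv)

lemma dir_deriv_along_line:
  assumes "real_polynomial_function g"
  shows "((\<lambda>t. g (x + t *\<^sub>R v)) has_real_derivative dir_deriv v g (x + t *\<^sub>R v)) (at t)"
proof -
  interpret bounded_linear "\<lambda>w. dir_deriv w g (x + t *\<^sub>R v)"
    by (rule bounded_linear_dir_deriv[OF assms])
  have "((\<lambda>t. x + t *\<^sub>R v) has_derivative (\<lambda>s. s *\<^sub>R v)) (at t)"
    by (auto intro!: derivative_eq_intros)
  from has_derivative_compose[OF this has_derivative_dir_deriv[OF assms]]
  show ?thesis
    by (simp add: has_field_derivative_def scaleR mult.commute[of _ "dir_deriv v g _"])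
qed

section \<open>Convex polynomials and their second derivatives\<close>

lemma convex_on_along_line:
  assumes "convex_on UNIV g"
  shows "convex_on UNIV (\<lambda>t. g (x + t *\<^sub>R v))"
proof (rule convex_onI)
  fix t a b :: real assume "0 < t" "t < 1"
  have "x + ((1 - t) *\<^sub>R a + t *\<^sub>R b) *\<^sub>R v
      = (1 - t) *\<^sub>R (x + a *\<^sub>R v) + t *\<^sub>R (x + b *\<^sub>R v)"
    by (simp add: algebra_simps)
  with convex_onD[OF assms, of t "x + a *\<^sub>R v" "x + b *\<^sub>R v"] \<open>0 < t\<close> \<open>t < 1\<close>
  show "g (x + ((1 - t) *\<^sub>R a + t *\<^sub>R b) *\<^sub>R v)
      \<le> (1 - t) * g (x + a *\<^sub>R v) + t * g (x + b *\<^sub>R v)"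
    by simp
qed simp

lemma convex_above_tangent:
  assumes "convex_on UNIV g" "real_polynomial_function g"
  shows "g x + dir_deriv (y - x) g x \<le> g y"
proof -
  have "dir_deriv (y - x) g (x + 0 *\<^sub>R (y - x)) * (1 - 0)
      \<le> g (x + 1 *\<^sub>R (y - x)) - g (x + 0 *\<^sub>R (y - x))"
    using convex_on_imp_above_tangent[OF convex_on_along_line[OF assms(1)],
        OF connected_UNIV _ _ dir_deriv_along_line[OF assms(2)]]
    by (metis UNIV_I interior_UNIV)
  then show ?thesis by simp
qed

text \<open>Along a line the slope of a convex function is monotone: adding the tangent inequalities at two
  points gives \<open>0 \<le> (b - a) * (s b - s a)\<close> for the slopes \<open>s a\<close> and \<open>s b\<close> there.\<close>

lemma second_dir_deriv_nonneg:
  assumes "convex_on UNIV g" "real_polynomial_function g"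
  shows "0 \<le> dir_deriv v (dir_deriv v g) x"
proof -
  define s where "s t = dir_deriv v g (x + t *\<^sub>R v)" for t
  have tangent: "g (x + a *\<^sub>R v) + (b - a) * s a \<le> g (x + b *\<^sub>R v)" for a b
    using convex_above_tangent[OF assms, of "x + a *\<^sub>R v" "x + b *\<^sub>R v"]
    by (simp add: s_def dir_deriv_scaleR[OF assms(2)] flip: scaleR_diff_left)
  have "mono_on UNIV s"
  proof (rule mono_onI)
    fix a b :: real assume "a \<le> b"
    have "0 \<le> (b - a) * (s b - s a)"
      using tangent[of a b] tangent[of b a] by (simp add: algebra_simps)
    with \<open>a \<le> b\<close> show "s a \<le> s b"
      by (cases "a = b") (auto simp: zero_le_mult_iff)
  qed
  moreover have "(s has_real_derivative dir_deriv v (dir_deriv v g) (x + 0 *\<^sub>R v)) (at 0)"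
    unfolding s_def
    by (rule dir_deriv_along_line[OF real_polynomial_function_dir_deriv[OF assms(2)]])
  ultimately show ?thesis
    using mono_on_imp_deriv_nonneg[of UNIV s _ 0] by simp
qed

text \<open>A positive semidefinite symmetric matrix with zero diagonal vanishes: its form on
  \<open>e\<^sub>i + s e\<^sub>j\<close> is \<open>2 * s\<close> times the off-diagonal entry, and this must be nonnegative for both signs
  of \<open>s\<close>.\<close>

lemma second_dir_deriv_eq_0:
  fixes g :: "real^'n \<Rightarrow> real"
  assumes "convex_on UNIV g" "real_polynomial_function g"
    and diag: "\<And>i. dir_deriv (axis i 1) (dir_deriv (axis i 1) g) x = 0"
  shows "dir_deriv v (dir_deriv w g) x = 0"
proof -
  define H where "H v w = dir_deriv v (dir_deriv w g) x" for v w
  have lin1: "linear (\<lambda>v. H v w)" for w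
    unfolding H_def
    by (intro bounded_linear.linear bounded_linear_dir_deriv real_polynomial_function_dir_deriv assms)
  have sym: "H v w = H w v" for v w
    unfolding H_def by (metis dir_deriv_commute[OF assms(2)])
  then have lin2: "linear (H v)" for v
    using lin1[of v] sym by (metis (no_types, lifting) ext)
  have nonneg: "0 \<le> H v v" for v
    unfolding H_def by (rule second_dir_deriv_nonneg[OF assms(1,2)])
  have "H (axis i 1) (axis j 1) = 0" for i j
  proof -
    let ?a = "axis i 1 :: real^'n" and ?b = "axis j 1 :: real^'n"
    have "H (?a + s *\<^sub>R ?b) (?a + s *\<^sub>R ?b) = 2 * s * H ?a ?b" for s
      using diag
      by (simp add: linear_add[OF lin1] linear_add[OF lin2] linear_scale[OF lin1]
          linear_scale[OF lin2] sym[of ?b ?a]) (simp add: H_def)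
    with nonneg[of "?a + 1 *\<^sub>R ?b"] nonneg[of "?a + (-1) *\<^sub>R ?b"] show ?thesis
      by (metis (no_types, opaque_lifting) mult_minus1_right mult_1_right neg_0_le_iff_le
          zero_le_mult_iff mult_minus_left order_antisym zero_less_numeral not_le)
  qed
  then have "H (axis i 1) w = 0" for i w
    by (subst basis_expansion[of w, symmetric])
       (simp add: linear_sum[OF lin2] scalar_mult_eq_scaleR linear_scale[OF lin2])
  then have "H v w = 0"
    by (subst basis_expansion[of v, symmetric])
       (simp add: linear_sum[OF lin1] scalar_mult_eq_scaleR linear_scale[OF lin1])
  then show ?thesis by (simp add: H_def)
qed

section \<open>Polynomials of bounded degree and affine functions\<close>

lemma polys_deg_le_const: "(\<lambda>x. c) \<in> polys_deg_le k"
  using polys_deg_le_monomial[of "\<lambda>_. 0" k c] by simp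

lemma polys_deg_le_cmult: "p \<in> polys_deg_le k \<Longrightarrow> (\<lambda>x. c * p x) \<in> polys_deg_le k"
  using polys_deg_le_mult[OF polys_deg_le_const[of c 0]] by fastforce

lemma polys_deg_le_diff:
  "p \<in> polys_deg_le k \<Longrightarrow> q \<in> polys_deg_le k \<Longrightarrow> (\<lambda>x. p x - q x) \<in> polys_deg_le k"
  using polys_deg_le_add[OF _ polys_deg_le_cmult[of q k "-1"]] by fastforce

lemma polys_deg_le_power:
  assumes "p \<in> polys_deg_le k" shows "(\<lambda>x. p x ^ m) \<in> polys_deg_le (m * k)"
  by (induction m) (auto intro: polys_deg_le_const polys_deg_le_mult[OF assms])

lemma polys_deg_le_coordinate: "(\<lambda>x :: real^'n. x $ i) \<in> polys_deg_le 1"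
proof -
  have "(\<Prod>j\<in>UNIV. (x $ j) ^ (if j = i then 1 else 0)) = x $ i" for x :: "real^'n"
    by (simp add: if_distrib[of "\<lambda>t. _ ^ t"] cong: if_cong)
  then show ?thesis
    using polys_deg_le_monomial[of "\<lambda>j :: 'n. if j = i then 1 else 0" 1 1] by simp
qed

text \<open>The function \<open>h j\<close> is the homogeneous part of degree \<open>j\<close>. A ray thus sees the degree of a
  multivariate polynomial, which reduces degree bounds to one variable.\<close>

lemma homogeneous_decomposition:
  fixes g :: "real^'n \<Rightarrow> real"
  assumes "g \<in> polys_deg_le k"
  shows "\<exists>h. (\<forall>j. h j \<in> polys_deg_le j) \<and> (\<forall>t v. g (t *\<^sub>R v) = (\<Sum>j\<le>k. h j v * t ^ j))"
proof -
  obtain c where g: "g = (\<lambda>x. \<Sum>\<alpha> | (\<Sum>i\<in>UNIV. \<alpha> i) \<le> k. c \<alpha> * (\<Prod>i\<in>UNIV. (x $ i) ^ \<alpha> i))"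
    using assms unfolding polys_deg_le_def by blast
  let ?s = "\<lambda>\<alpha> :: 'n \<Rightarrow> nat. \<Sum>i\<in>UNIV. \<alpha> i"
  define h where "h j v = (\<Sum>\<alpha> | \<alpha> \<in> {\<alpha>. ?s \<alpha> \<le> k} \<and> ?s \<alpha> = j. c \<alpha> * (\<Prod>i\<in>UNIV. (v $ i) ^ \<alpha> i))"
    for j v
  have "h j \<in> polys_deg_le j" for j
    unfolding h_def
    by (intro polys_deg_le_sum polys_deg_le_monomial) (auto intro: finite_subset[OF _ finite_exponents])
  moreover have "g (t *\<^sub>R v) = (\<Sum>j\<le>k. h j v * t ^ j)" for t v
  proof -
    have "g (t *\<^sub>R v) = (\<Sum>\<alpha> | ?s \<alpha> \<le> k. c \<alpha> * (\<Prod>i\<in>UNIV. (v $ i) ^ \<alpha> i) * t ^ ?s \<alpha>)"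
      unfolding g by (simp add: power_mult_distrib prod.distrib power_sum mult_ac)
    also have "\<dots> = (\<Sum>j\<le>k. \<Sum>\<alpha> | \<alpha> \<in> {\<alpha>. ?s \<alpha> \<le> k} \<and> ?s \<alpha> = j.
        c \<alpha> * (\<Prod>i\<in>UNIV. (v $ i) ^ \<alpha> i) * t ^ ?s \<alpha>)"
      by (rule sum.group[symmetric]) (auto intro: finite_exponents)
    also have "\<dots> = (\<Sum>j\<le>k. h j v * t ^ j)"
      unfolding h_def by (intro sum.cong refl) (simp add: sum_distrib_right)
    finally show ?thesis .
  qed
  ultimately show ?thesis by blast
qed

lemma polys_deg_le_along_line:
  assumes "g \<in> polys_deg_le k"
  shows "\<exists>a. \<forall>t. g (t *\<^sub>R v) = (\<Sum>j\<le>k. a j * t ^ j)"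
proof -
  from homogeneous_decomposition[OF assms] obtain h where
    "\<forall>t v. g (t *\<^sub>R v) = (\<Sum>j\<le>k. h j v * t ^ j)"
    by (elim exE conjE)
  then show ?thesis
    by (intro exI[of _ "\<lambda>j. h j v"]) simp
qed

lemma affine_fun_alt: "affine_fun h \<longleftrightarrow> (\<exists>L c. linear L \<and> h = (\<lambda>x. L x + c))"
proof
  assume "affine_fun h"
  then obtain a b where "h = (\<lambda>x. a \<bullet> x + b)" by (auto simp: affine_fun_def)
  moreover have "linear (\<lambda>x. a \<bullet> x)"
    by (intro bounded_linear.linear bounded_linear_inner_right)
  ultimately show "\<exists>L c. linear L \<and> h = (\<lambda>x. L x + c)" by blast
next
  assume "\<exists>L c. linear L \<and> h = (\<lambda>x. L x + c)"
  then obtain L c where L: "linear L" "h = (\<lambda>x. L x + c)" by blast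
  then have "L x = adjoint L 1 \<bullet> x" for x
    using adjoint_works[OF L(1), of x 1] by (simp add: inner_commute)
  with L show "affine_fun h" by (auto simp: affine_fun_def)
qed

lemma affine_fun_convex_combination:
  assumes "affine_fun h"
  shows "h ((1 - t) *\<^sub>R x + t *\<^sub>R y) = (1 - t) * h x + t * h y"
proof -
  obtain a b where "\<And>x. h x = a \<bullet> x + b"
    using assms unfolding affine_fun_def by blast
  then show ?thesis
    by (simp only: inner_add_right inner_scaleR_right) (simp add: algebra_simps)
qed

lemma affine_fun_add: "affine_fun g \<Longrightarrow> affine_fun h \<Longrightarrow> affine_fun (\<lambda>x. g x + h x)"
  unfolding affine_fun_def by (metis (no_types) add.assoc add.left_commute inner_add_left)

lemma affine_fun_cmult: "affine_fun h \<Longrightarrow> affine_fun (\<lambda>x. c * h x)"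
  unfolding affine_fun_def by (metis inner_scaleR_left distrib_left)

lemma affine_fun_const: "affine_fun (\<lambda>x. c)"
  unfolding affine_fun_def by (metis inner_zero_left add_0)

lemma affine_fun_in_polys:
  fixes h :: "real^'n \<Rightarrow> real"
  assumes "affine_fun h" "1 \<le> k" shows "h \<in> polys_deg_le k"
proof -
  obtain a b where h: "h = (\<lambda>x. (\<Sum>i\<in>UNIV. a $ i * x $ i) + b)"
    using assms by (auto simp: affine_fun_def inner_vec_def)
  show ?thesis
    unfolding h
    by (intro polys_deg_le_mono[OF _ assms(2)] polys_deg_le_add polys_deg_le_sum polys_deg_le_const
        polys_deg_le_cmult polys_deg_le_coordinate) auto
qed

lemma convex_on_affine: "affine_fun h \<Longrightarrow> convex_on UNIV h"
  by (rule convex_onI) (auto simp: affine_fun_convex_combination)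

section \<open>The mean trace of the Hessian\<close>

definition laplacian :: "(real^'n \<Rightarrow> real) \<Rightarrow> real^'n \<Rightarrow> real" where
  "laplacian g x = (\<Sum>i\<in>UNIV. dir_deriv (axis i 1) (dir_deriv (axis i 1) g) x)"

lemma trace_hessian: "trace (hessian g x) = laplacian g x"
proof -
  have "dir_deriv v g = (\<lambda>y. frechet_derivative g (at y) v)" for v
    by (rule ext) (simp add: dir_deriv_def)
  then show ?thesis
    unfolding laplacian_def trace_def hessian_def by (simp add: dir_deriv_def)
qed

lemma laplacian_add:
  assumes "real_polynomial_function p" "real_polynomial_function q"
  shows "laplacian (\<lambda>x. p x + q x) x = laplacian p x + laplacian q x"
  using assms
  by (simp add: laplacian_def dir_deriv_add real_polynomial_function_dir_deriv sum.distrib)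

lemma laplacian_cmult:
  assumes "real_polynomial_function p"
  shows "laplacian (\<lambda>x. c * p x) x = c * laplacian p x"
  using assms
  by (simp add: laplacian_def dir_deriv_cmult real_polynomial_function_dir_deriv sum_distrib_left)

lemma continuous_on_laplacian:
  assumes "real_polynomial_function p"
  shows "continuous_on UNIV (laplacian p)"
  unfolding laplacian_def[abs_def]
  by (intro continuous_on_sum continuous_on_polymonial_function)
     (simp add: real_polynomial_function_dir_deriv assms flip: real_polynomial_function_eq)

lemma integrable_sphere_measure:
  fixes h :: "real^'n \<Rightarrow> real"
  assumes "continuous_on UNIV h"
  shows "integrable sphere_measure h"
proof -
  interpret finite_measure "sphere_measure :: (real^'n) measure"
    by (rule finite_measureI) (simp add: emeasure_sphere_measure_total)
  have "compact (h ` sphere 0 1)"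
    by (intro compact_continuous_image continuous_on_subset[OF assms]) auto
  from compact_imp_bounded[OF this]
  obtain B where B: "\<forall>y \<in> h ` sphere 0 1. norm y \<le> B"
    unfolding bounded_iff ..
  have "h \<in> borel_measurable (restrict_space borel (sphere 0 1))"
    using assms by (intro measurable_restrict_space1 borel_measurable_continuous_onI)
  then have meas: "h \<in> borel_measurable sphere_measure"
    by (simp cong: measurable_cong_sets)
  show ?thesis
    by (rule integrable_const_bound[of h B]) (use B meas in \<open>auto intro!: AE_I2\<close>)
qed

text \<open>Nonempty relatively open subsets of the sphere have positive measure, because the cone over such
  a set contains a nonempty open set \<open>C\<close>.\<close>

lemma integral_sphere_eq_0_imp:
  fixes h :: "real^'n \<Rightarrow> real"
  assumes cont: "continuous_on UNIV h" and nonneg: "\<And>x. 0 \<le> h x"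
    and zero: "(LINT x|sphere_measure. h x) = 0" and "norm x = 1"
  shows "h x = 0"
proof (rule ccontr)
  assume "h x \<noteq> 0"
  define U where "U = {y. h y \<noteq> 0}"
  define r where "r y = y /\<^sub>R norm y" for y :: "real^'n"
  define C where "C = (ball 0 1 - {0}) \<inter> r -` U"
  have "open U"
    unfolding U_def using cont by (intro open_Collect_neq) auto
  have A_borel: "sphere 0 1 \<inter> U \<in> sets borel"
    using \<open>open U\<close> by (intro sets.Int) auto
  have AE: "AE y in sphere_measure. h y = 0"
    using integral_nonneg_eq_0_iff_AE[OF integrable_sphere_measure[OF cont]] nonneg zero by simp
  then have AE: "AE y in sphere_measure. y \<notin> sphere 0 1 \<inter> U"
    by (rule AE_mp) (simp add: U_def)
  have "sphere 0 1 \<inter> U \<in> sets sphere_measure"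
    unfolding sets_sphere_measure by (subst sets_restrict_space_iff) (use A_borel in auto)
  from AE_iff_null_sets[OF this] AE have "emeasure sphere_measure (sphere 0 1 \<inter> U) = 0"
    by blast
  moreover have "emeasure sphere_measure (sphere 0 1 \<inter> U)
      = of_nat CARD('n) * emeasure lborel {y \<in> cball 0 1 - {0}. y /\<^sub>R norm y \<in> sphere 0 1 \<inter> U}"
    by (rule emeasure_sphere_measure[OF A_borel]) simp
  moreover have "{y \<in> cball 0 1 - {0}. y /\<^sub>R norm y \<in> sphere 0 1 \<inter> U}
      = (cball 0 1 - {0}) \<inter> r -` U"
    by (auto simp: r_def)
  ultimately have null: "emeasure lborel ((cball 0 1 - {0}) \<inter> r -` U) = 0"
    by simp
  have "r \<in> borel_measurable borel"
    unfolding r_def[abs_def] by measurable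
  from measurable_sets[OF this, of U] \<open>open U\<close>
  have meas: "(cball 0 1 - {0}) \<inter> r -` U \<in> sets lborel"
    by (simp add: sets.Int)
  have "continuous_on (ball 0 1 - {0}) r"
    unfolding r_def[abs_def] by (intro continuous_intros) auto
  then have "open C"
    unfolding C_def by (intro continuous_open_preimage \<open>open U\<close>) auto
  have "C \<in> null_sets lborel"
  proof (rule null_sets_subset)
    show "(cball 0 1 - {0}) \<inter> r -` U \<in> null_sets lborel"
      using null meas by (rule null_setsI)
    show "C \<subseteq> (cball 0 1 - {0}) \<inter> r -` U"
      unfolding C_def by (intro Int_mono Diff_mono ball_subset_cball order_refl)
  qed (use \<open>open C\<close> in simp)
  then have "negligible C"
    by (simp add: negligible_iff_null_sets null_sets_completionI)
  moreover have "(1/2) *\<^sub>R x \<in> C"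
    using \<open>norm x = 1\<close> \<open>h x \<noteq> 0\<close> by (auto simp: C_def U_def r_def)
  ultimately show False
    using open_not_negligible[OF \<open>open C\<close>] by blast
qed

lemma sphere_area_pos: "n > 0 \<Longrightarrow> sphere_area n > 0"
  unfolding sphere_area_def by (intro divide_pos_pos mult_pos_pos Gamma_real_pos) auto

lemma mean_trace_hessian_eq:
  "mean_trace_hessian (g :: real^'n \<Rightarrow> real)
     = (LINT x|sphere_measure. laplacian g x) / sphere_area CARD('n)"
  by (simp add: mean_trace_hessian_def trace_hessian)

lemma mean_trace_hessian_add:
  assumes "real_polynomial_function p" "real_polynomial_function q"
  shows "mean_trace_hessian (\<lambda>x. p x + q x) = mean_trace_hessian p + mean_trace_hessian q"
  by (simp add: mean_trace_hessian_eq laplacian_add assms integrable_sphere_measure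
      continuous_on_laplacian add_divide_distrib)

lemma mean_trace_hessian_cmult:
  assumes "real_polynomial_function p"
  shows "mean_trace_hessian (\<lambda>x. c * p x) = c * mean_trace_hessian p"
  by (simp add: mean_trace_hessian_eq laplacian_cmult assms)

lemma mean_trace_hessian_diff:
  assumes "real_polynomial_function p" "real_polynomial_function q"
  shows "mean_trace_hessian (\<lambda>x. p x - q x) = mean_trace_hessian p - mean_trace_hessian q"
proof -
  have "real_polynomial_function (\<lambda>x. p x - q x)"
    using assms by auto
  from mean_trace_hessian_add[OF this assms(2)] show ?thesis by simp
qed

lemma mean_trace_hessian_sum:
  assumes "finite A" "\<And>a. a \<in> A \<Longrightarrow> real_polynomial_function (p a)"
  shows "mean_trace_hessian (\<lambda>x. \<Sum>a\<in>A. c a * p a x) = (\<Sum>a\<in>A. c a * mean_trace_hessian (p a))"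
  using assms
proof (induction A rule: finite_induct)
  case empty
  show ?case
    using mean_trace_hessian_cmult[of "\<lambda>_. 0" 0] by (simp add: real_polynomial_function.intros(2))
next
  case (insert a A)
  then have "real_polynomial_function (\<lambda>x. c a * p a x)" "real_polynomial_function (\<lambda>x. \<Sum>a\<in>A. c a * p a x)"
    by (auto intro!: real_polynomial_function_sum)
  with insert show ?case
    by (simp add: mean_trace_hessian_add mean_trace_hessian_cmult)
qed

lemma mean_trace_hessian_affine:
  assumes "affine_fun h" shows "mean_trace_hessian h = 0"
proof -
  obtain a b where h: "h = (\<lambda>x. a \<bullet> x + b)"
    using assms by (auto simp: affine_fun_def)
  have "dir_deriv v h = (\<lambda>x. a \<bullet> v)" for v
    unfolding h
    by (subst dir_deriv_add) (auto simp: dir_deriv_linear dir_deriv_const bounded_linear_inner_right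
        intro: real_polynomial_function.intros)
  then show ?thesis
    by (simp add: mean_trace_hessian_eq laplacian_def dir_deriv_const)
qed

lemma laplacian_nonneg:
  "convex_on UNIV g \<Longrightarrow> real_polynomial_function g \<Longrightarrow> 0 \<le> laplacian g x"
  by (auto simp: laplacian_def intro!: sum_nonneg second_dir_deriv_nonneg)

lemma mean_trace_hessian_nonneg:
  fixes g :: "real^'n \<Rightarrow> real"
  assumes "convex_on UNIV g" "real_polynomial_function g"
  shows "0 \<le> mean_trace_hessian g"
  using laplacian_nonneg[OF assms] sphere_area_pos[of "CARD('n)"]
  by (simp add: mean_trace_hessian_eq)

lemma mean_trace_hessian_eq_0_imp:
  fixes g :: "real^'n \<Rightarrow> real"
  assumes "convex_on UNIV g" "real_polynomial_function g" "mean_trace_hessian g = 0" "norm x = 1"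
  shows "dir_deriv v (dir_deriv w g) x = 0"
proof (rule second_dir_deriv_eq_0[OF assms(1,2)])
  fix i
  have "(LINT x|sphere_measure. laplacian g x) = 0"
    using assms(3) sphere_area_pos[of "CARD('n)"] by (simp add: mean_trace_hessian_eq)
  then have "laplacian g x = 0"
    using integral_sphere_eq_0_imp[OF continuous_on_laplacian[OF assms(2)]
        laplacian_nonneg[OF assms(1,2)] _ assms(4)] by simp
  then show "dir_deriv (axis i 1) (dir_deriv (axis i 1) g) x = 0"
    unfolding laplacian_def
    by (subst (asm) sum_nonneg_eq_0_iff) (auto intro: second_dir_deriv_nonneg[OF assms(1,2)])
qed

section \<open>Convex polynomials with vanishing mean trace are affine\<close>

lemma real_polynomial_function_along_line:
  assumes "real_polynomial_function g"
  shows "real_polynomial_function (\<lambda>t. g (x + t *\<^sub>R v))"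
proof -
  have "polynomial_function (\<lambda>t. x + t *\<^sub>R v)"
    by (intro polynomial_function_add polynomial_function_const polynomial_function_bounded_linear
        bounded_linear_scaleR_left)
  from real_polynomial_function_compose[OF this assms] show ?thesis by (simp add: o_def)
qed

text \<open>A one-variable polynomial with infinitely many zeros has only zero coefficients.\<close>

lemma real_polynomial_function_const_on_interval:
  fixes p :: "real \<Rightarrow> real"
  assumes "real_polynomial_function p" "a < b" "\<And>t. a \<le> t \<Longrightarrow> t \<le> b \<Longrightarrow> p t = c"
  shows "p s = c"
proof -
  have "real_polynomial_function (\<lambda>t. p t - c)"
    using assms(1) by (intro real_polynomial_function_diff real_polynomial_function.intros(2))
  then obtain e n where e: "(\<lambda>t. p t - c) = (\<lambda>t. \<Sum>i\<le>n. e i * t ^ i)"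
    unfolding real_polynomial_function_iff_sum by blast
  have e': "p t - c = (\<Sum>i\<le>n. e i * t ^ i)" for t
    using fun_cong[OF e, of t] by simp
  have "{a..b} \<subseteq> {t. (\<Sum>i\<le>n. e i * t ^ i) = 0}"
    using assms(3) by (auto simp flip: e')
  moreover have "infinite {a..b}"
    using assms(2) by simp
  ultimately have "infinite {t. (\<Sum>i\<le>n. e i * t ^ i) = 0}"
    using infinite_super by blast
  then have "\<forall>i\<le>n. e i = 0"
    using polyfun_finite_roots[of e n] by blast
  then show ?thesis
    using e'[of s] by simp
qed

text \<open>A connectedness argument needs an open set, so \<open>F\<close> is extended radially to the punctured space,
  which is connected from dimension two on; the extension has derivative zero by the chain rule.\<close>

lemma constant_on_sphere:
  fixes F :: "real^'n \<Rightarrow> real"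
  assumes "CARD('n) \<ge> 2" "real_polynomial_function F"
    and zero: "\<And>v x. norm x = 1 \<Longrightarrow> dir_deriv v F x = 0"
    and "norm x = 1" "norm y = 1"
  shows "F x = F y"
proof -
  let ?G = "\<lambda>z. F (z /\<^sub>R norm z)"
  have deriv: "(?G has_derivative (\<lambda>h. 0)) (at z)" if "z \<noteq> 0" for z
  proof -
    have "(\<lambda>z :: real^'n. z /\<^sub>R norm z) differentiable (at z)"
      using that by (intro differentiable_scaleR differentiable_inverse differentiable_ident
          differentiable_norm_at) auto
    then obtain r' where r': "((\<lambda>z :: real^'n. z /\<^sub>R norm z) has_derivative r') (at z)"
      unfolding differentiable_def by blast
    have "(F has_derivative (\<lambda>v. 0)) (at (z /\<^sub>R norm z))"
      using has_derivative_dir_deriv[OF assms(2), of "z /\<^sub>R norm z"] that by (simp add: zero)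
    from has_derivative_compose[OF r' this] show ?thesis .
  qed
  have "?G x = ?G y"
  proof (rule has_derivative_zero_unique_strong_connected[of "- {0}" "{}" ?G y "?G y" x])
    show "connected (- {0 :: real^'n})"
      using assms(1) by (intro connected_punctured_universe) simp
    show "continuous_on (- {0}) ?G"
      by (intro continuous_at_imp_continuous_on ballI has_derivative_continuous[OF deriv]) simp
    show "x \<in> - {0}" "y \<in> - {0}" using assms(4,5) by auto
    show "(?G has_derivative (\<lambda>h. 0)) (at z within - {0})" if "z \<in> - {0} - {}" for z
      using that by (simp add: has_derivative_at_withinI[OF deriv])
    show "open (- {0 :: real^'n})" by (rule open_Compl) simp
  qed (rule finite.emptyI refl)+
  then show ?thesis using assms(4,5) by simp
qed

text \<open>The partial derivatives of \<open>g\<close> are constant on the sphere. With \<open>L\<close> the common gradient,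
  every point of the sphere minimizes \<open>k = g - L\<close>, and convexity between antipodal points makes
  \<open>k\<close> constant on each diameter, hence on each line through the origin.\<close>

lemma affine_if_hessian_zero_on_sphere:
  fixes g :: "real^'n \<Rightarrow> real"
  assumes "CARD('n) \<ge> 2" "convex_on UNIV g" and poly: "real_polynomial_function g"
    and zero: "\<And>v w x. norm x = 1 \<Longrightarrow> dir_deriv v (dir_deriv w g) x = 0"
  shows "affine_fun g"
proof -
  obtain e :: "real^'n" where e: "norm e = 1"
    using vector_choose_size[of 1] by auto
  define L where "L v = dir_deriv v g e" for v
  have "linear L"
    unfolding L_def by (rule bounded_linear.linear[OF bounded_linear_dir_deriv[OF poly]])
  have grad: "dir_deriv v g z = L v" if "norm z = 1" for v z
    unfolding L_def
    using constant_on_sphere[OF assms(1) real_polynomial_function_dir_deriv[OF poly] _ that e] zero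
    by blast
  define k where "k y = g y - L y" for y
  have min: "k z \<le> k y" if "norm z = 1" for y z
    using convex_above_tangent[OF assms(2) poly, of z y] grad[OF that]
    by (simp add: k_def linear_diff[OF \<open>linear L\<close>])
  have affine_L: "affine_fun (\<lambda>y. - L y)"
    unfolding affine_fun_alt
    by (intro exI[of _ "\<lambda>y. - L y"] exI[of _ 0]) (simp add: \<open>linear L\<close> linear_compose_neg)
  have "convex_on UNIV k"
    using convex_on_add[OF assms(2) convex_on_affine[OF affine_L]]
    by (simp add: k_def[abs_def])
  have "real_polynomial_function k"
    unfolding k_def
    using poly \<open>linear L\<close>
    by (intro real_polynomial_function_diff) (auto intro: real_polynomial_function.intros simp: linear_conv_bounded_linear)
  have on_segment: "k (t *\<^sub>R z) = k e" if z: "norm z = 1" and "-1 \<le> t" "t \<le> 1" for z t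
  proof (rule antisym)
    have "k ((1 - (1 - t) / 2) *\<^sub>R z + ((1 - t) / 2) *\<^sub>R (- z))
        \<le> (1 - (1 - t) / 2) * k z + (1 - t) / 2 * k (- z)"
      using that by (intro convex_onD[OF \<open>convex_on UNIV k\<close>]) auto
    also have "(1 - (1 - t) / 2) *\<^sub>R z + ((1 - t) / 2) *\<^sub>R (- z)
        = ((1 - (1 - t) / 2) - (1 - t) / 2) *\<^sub>R z"
      by (simp only: scaleR_diff_left scaleR_minus_right add_uminus_conv_diff)
    also have "(1 - (1 - t) / 2) - (1 - t) / 2 = t"
      by (simp add: field_simps)
    also have "k z = k e"
      by (intro antisym min z e)
    also have "k (- z) = k e"
      by (intro antisym min) (simp_all add: z e)
    finally show "k (t *\<^sub>R z) \<le> k e" by (simp add: field_simps)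
  qed (rule min[OF e])
  have on_line: "k (t *\<^sub>R z) = k e" if "norm z = 1" for z t
    using real_polynomial_function_const_on_interval
      [OF real_polynomial_function_along_line[OF \<open>real_polynomial_function k\<close>, of 0 z], of "-1" 1 "k e" t]
      on_segment[OF that] by simp
  have "k y = k e" for y
  proof (cases "y = 0")
    case True
    then show ?thesis using on_line[OF e, of 0] by simp
  next
    case False
    then show ?thesis using on_line[of "y /\<^sub>R norm y" "norm y"] by simp
  qed
  then have "g = (\<lambda>y. L y + k e)"
    by (auto simp: k_def fun_eq_iff algebra_simps)
  with \<open>linear L\<close> show ?thesis
    unfolding affine_fun_alt by blast
qed

lemma ex_spanning_unit_vector_dim_1:
  fixes x :: "real^'n"
  assumes "CARD('n) = 1"
  shows "\<exists>e :: real^'n. norm e = 1 \<and> (\<forall>x. \<exists>t. x = t *\<^sub>R e)"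
proof -
  obtain i :: 'n where i: "(UNIV :: 'n set) = {i}"
    using assms by (auto simp: card_1_singleton_iff)
  have "x = (x $ i) *\<^sub>R axis i 1" for x :: "real^'n"
  proof (rule vec_eq_iff[THEN iffD2], rule allI)
    fix j
    have "j = i" using i by blast
    then show "x $ j = (x $ i *\<^sub>R axis i 1) $ j" by simp
  qed
  then show ?thesis
    by (intro exI[of _ "axis i 1"]) auto
qed

text \<open>A nonnegative quadratic that vanishes at the two points \<open>1\<close> and \<open>-1\<close> is zero. Degree four of
  \<open>g\<close> is the threshold: for \<open>g'' x = (x\<^sup>2 - 1)\<^sup>2\<close> the conclusion fails.\<close>

lemma affine_if_quartic_dim_1:
  fixes g :: "real^'n \<Rightarrow> real"
  assumes "CARD('n) = 1" "g \<in> polys_deg_le 4" "convex_on UNIV g"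
    and zero: "\<And>v w x. norm x = 1 \<Longrightarrow> dir_deriv v (dir_deriv w g) x = 0"
  shows "affine_fun g"
proof -
  obtain e :: "real^'n" where e: "norm e = 1" "\<And>x. \<exists>t. x = t *\<^sub>R e"
    using ex_spanning_unit_vector_dim_1[OF assms(1)] by blast
  have poly: "real_polynomial_function g"
    using assms(2) real_polynomial_function_iff_polys_deg_le by blast
  obtain a where "\<forall>t. g (t *\<^sub>R e) = (\<Sum>j\<le>4. a j * t ^ j)"
    using polys_deg_le_along_line[OF assms(2), of e] by blast
  then have a: "g (t *\<^sub>R e) = a 0 + a 1 * t + a 2 * t ^ 2 + a 3 * t ^ 3 + a 4 * t ^ 4" for t
    by (simp add: numeral_eq_Suc)
  have deriv: "dir_deriv e g (t *\<^sub>R e) = a 1 + 2 * a 2 * t + 3 * a 3 * t ^ 2 + 4 * a 4 * t ^ 3" for t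
  proof (rule DERIV_unique)
    show "((\<lambda>t. g (t *\<^sub>R e)) has_real_derivative dir_deriv e g (t *\<^sub>R e)) (at t)"
      using dir_deriv_along_line[OF poly, where x = 0 and v = e and t = t] by simp
    show "((\<lambda>t. g (t *\<^sub>R e)) has_real_derivative
        a 1 + 2 * a 2 * t + 3 * a 3 * t ^ 2 + 4 * a 4 * t ^ 3) (at t)"
      unfolding a by (auto intro!: derivative_eq_intros)
  qed
  have second: "dir_deriv e (dir_deriv e g) (t *\<^sub>R e) = 2 * a 2 + 6 * a 3 * t + 12 * a 4 * t ^ 2" for t
  proof (rule DERIV_unique)
    show "((\<lambda>t. dir_deriv e g (t *\<^sub>R e)) has_real_derivative dir_deriv e (dir_deriv e g) (t *\<^sub>R e)) (at t)"
      using dir_deriv_along_line[OF real_polynomial_function_dir_deriv[OF poly], where x = 0 and v = e and t = t] by simp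
    show "((\<lambda>t. dir_deriv e g (t *\<^sub>R e)) has_real_derivative
        2 * a 2 + 6 * a 3 * t + 12 * a 4 * t ^ 2) (at t)"
      unfolding deriv by (auto intro!: derivative_eq_intros)
  qed
  have "2 * a 2 + 6 * a 3 * t + 12 * a 4 * t ^ 2 \<ge> 0" for t
    using second_dir_deriv_nonneg[OF assms(3) poly, of e "t *\<^sub>R e"] by (simp add: second)
  \<comment> \<open>The zeros at \<open>1\<close> and \<open>-1\<close> leave only multiples of \<open>t\<^sup>2 - 1\<close>; the signs at \<open>0\<close>, inside the zeros, and at \<open>2\<close>,
     outside them, then exclude all but zero.\<close>
  from this[of 0] this[of 2] have "a 2 \<ge> 0" "2 * a 2 + 12 * a 3 + 48 * a 4 \<ge> 0"
    by simp_all
  moreover have "2 * a 2 + 6 * a 3 + 12 * a 4 = 0" "2 * a 2 - 6 * a 3 + 12 * a 4 = 0"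
    using zero[where v = e and w = e and x = "1 *\<^sub>R e"] zero[where v = e and w = e and x = "(-1) *\<^sub>R e"] e(1)
    unfolding second by simp_all
  ultimately have "a 2 = 0" "a 3 = 0" "a 4 = 0"
    by linarith+
  with a have line: "g (t *\<^sub>R e) = a 0 + a 1 * t" for t by simp
  have "g x = (a 1 *\<^sub>R e) \<bullet> x + a 0" for x
  proof -
    obtain t where "x = t *\<^sub>R e" using e(2) by blast
    then show ?thesis
      using e(1) by (simp add: line dot_square_norm)
  qed
  then show ?thesis unfolding affine_fun_def by blast
qed

lemma affine_if_mean_trace_hessian_eq_0:
  fixes g :: "real^'n \<Rightarrow> real"
  assumes "g \<in> polys_deg_le (2 * d)" "CARD('n) \<ge> 2 \<or> d \<le> 2"
    and "convex_on UNIV g" "mean_trace_hessian g = 0"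
  shows "affine_fun g"
proof -
  have poly: "real_polynomial_function g"
    using assms(1) real_polynomial_function_iff_polys_deg_le by blast
  note zero = mean_trace_hessian_eq_0_imp[OF assms(3) poly assms(4)]
  show ?thesis
  proof (cases "CARD('n) \<ge> 2")
    case True
    from affine_if_hessian_zero_on_sphere[OF this assms(3) poly zero] show ?thesis .
  next
    case False
    then have "CARD('n) = 1"
      by (metis One_nat_def Suc_1 Suc_leI not_less_eq_eq zero_less_card_finite le_antisym)
    moreover have "g \<in> polys_deg_le 4"
      using False assms(1,2) by (auto elim: polys_deg_le_mono)
    ultimately show ?thesis
      using affine_if_quartic_dim_1 assms(3) zero by blast
  qed
qed

section \<open>Every polynomial is a difference of convex polynomials\<close>

text \<open>The sum is an iterated finite difference of \<open>x \<mapsto> x ^ k\<close> with steps \<open>y a\<close>, up to sign. Adding one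
  element to \<open>A\<close> takes one more difference, and the binomial theorem expresses it by the sums for
  smaller exponents. The free shift \<open>x\<close> and the smaller exponents are there for the induction.\<close>

lemma signed_subset_sum_power:
  fixes y :: "'a \<Rightarrow> real"
  assumes "finite A" "k \<le> card A"
  shows "(\<Sum>S\<in>Pow A. (-1) ^ card S * (x + sum y S) ^ k)
     = (if k = card A then (-1) ^ card A * fact (card A) * prod y A else 0)"
  using assms
proof (induction A arbitrary: x k rule: finite_induct)
  case empty
  then show ?case by simp
next
  case (insert a A)
  define F where "F j = (\<Sum>S\<in>Pow A. (-1) ^ card S * (x + sum y S) ^ j)" for j
  have inj: "inj_on (insert a) (Pow A)"
    using insert.hyps by (auto simp: inj_on_def)
  have fin: "finite S \<and> a \<notin> S" if "S \<in> Pow A" for S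
    using that insert.hyps finite_subset by auto
  have "(\<Sum>S\<in>Pow (insert a A). (-1) ^ card S * (x + sum y S) ^ k)
      = F k + (\<Sum>S\<in>insert a ` Pow A. (-1) ^ card S * (x + sum y S) ^ k)"
    unfolding Pow_insert F_def using insert.hyps by (intro sum.union_disjoint) auto
  also have "(\<Sum>S\<in>insert a ` Pow A. (-1) ^ card S * (x + sum y S) ^ k)
      = - (\<Sum>S\<in>Pow A. (-1) ^ card S * ((x + sum y S) + y a) ^ k)"
    by (subst sum.reindex[OF inj])
       (auto simp: fin sum_negf[symmetric] algebra_simps intro!: sum.cong)
  also have "(\<Sum>S\<in>Pow A. (-1) ^ card S * ((x + sum y S) + y a) ^ k)
      = (\<Sum>S\<in>Pow A. \<Sum>j\<le>k. (k choose j) * y a ^ (k - j) * ((-1) ^ card S * (x + sum y S) ^ j))"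
    by (simp add: binomial_ring sum_distrib_left mult_ac)
  also have "\<dots> = (\<Sum>j\<le>k. (k choose j) * y a ^ (k - j) * F j)"
    unfolding F_def by (subst sum.swap) (simp add: sum_distrib_left)
  also have "\<dots> = F k + (\<Sum>j<k. (k choose j) * y a ^ (k - j) * F j)"
    by (simp add: atMost_Suc_eq_insert_0 flip: lessThan_Suc_atMost)
  also have "(\<Sum>j<k. (k choose j) * y a ^ (k - j) * F j)
      = (\<Sum>j<k. if j = card A then (k choose j) * y a ^ (k - j)
          * ((-1) ^ card A * fact (card A) * prod y A) else 0)"
    unfolding F_def using insert.prems insert.hyps
    by (intro sum.cong refl) (subst insert.IH, auto)
  also have "\<dots> = (if k = Suc (card A)
      then Suc (card A) * y a * ((-1) ^ card A * fact (card A) * prod y A) else 0)"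
    using insert.prems insert.hyps by (auto simp: sum.delta)
  finally show ?case
    using insert.hyps by (auto simp: algebra_simps)
qed

text \<open>A product of numbers as a linear combination of powers of their subset sums. Applied to affine
  forms it writes monomials as combinations of convex polynomials.\<close>

lemma polarization:
  fixes y :: "'a \<Rightarrow> real"
  assumes "finite A"
  shows "prod y A = (\<Sum>S\<in>Pow A. (-1) ^ card S * (-1) ^ card A / fact (card A) * (sum y S) ^ card A)"
proof -
  have "(\<Sum>S\<in>Pow A. (-1) ^ card S * (-1) ^ card A / fact (card A) * (sum y S) ^ card A)
      = (-1) ^ card A / fact (card A) * (\<Sum>S\<in>Pow A. (-1) ^ card S * (0 + sum y S) ^ card A)"
    by (simp add: sum_distrib_left mult_ac)
  also have "\<dots> = prod y A"
    by (subst signed_subset_sum_power[OF assms order_refl])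
       (simp add: power_mult_distrib[symmetric] flip: mult.assoc)
  finally show ?thesis by simp
qed

lemma convex_on_even_power_affine:
  assumes "affine_fun h" "even m" shows "convex_on UNIV (\<lambda>x. h x ^ m)"
proof (rule convex_onI)
  fix t :: real and x y assume "0 < t" "t < 1"
  then show "h ((1 - t) *\<^sub>R x + t *\<^sub>R y) ^ m \<le> (1 - t) * h x ^ m + t * h y ^ m"
    using convex_onD[OF convex_power_even[OF assms(2)], of t "h x" "h y"]
    by (simp add: affine_fun_convex_combination[OF assms(1)])
qed simp

definition convex_difference :: "nat \<Rightarrow> (real^'n \<Rightarrow> real) \<Rightarrow> bool" where
  "convex_difference k p \<longleftrightarrow> (\<exists>g\<in>polys_deg_le k. \<exists>h\<in>polys_deg_le k.
     convex_on UNIV g \<and> convex_on UNIV h \<and> p = (\<lambda>x. g x - h x))"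

lemma convex_difference_add:
  assumes "convex_difference k p" "convex_difference k q"
  shows "convex_difference k (\<lambda>x. p x + q x)"
proof -
  obtain g h g' h' where *: "{g, h, g', h'} \<subseteq> polys_deg_le k" "convex_on UNIV g" "convex_on UNIV h"
    "convex_on UNIV g'" "convex_on UNIV h'" "p = (\<lambda>x. g x - h x)" "q = (\<lambda>x. g' x - h' x)"
    using assms unfolding convex_difference_def by auto
  show ?thesis
    unfolding convex_difference_def
    by (rule bexI[of _ "\<lambda>x. g x + g' x"], rule bexI[of _ "\<lambda>x. h x + h' x"])
       (use * in \<open>auto intro: polys_deg_le_add\<close>)
qed

lemma convex_difference_cmult:
  assumes "convex_difference k p" shows "convex_difference k (\<lambda>x. c * p x)"
proof -
  obtain g h where *: "g \<in> polys_deg_le k" "h \<in> polys_deg_le k" "convex_on UNIV g" "convex_on UNIV h"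
    "p = (\<lambda>x. g x - h x)"
    using assms unfolding convex_difference_def by auto
  show ?thesis
  proof (cases "0 \<le> c")
    case True
    show ?thesis
      unfolding convex_difference_def
      by (rule bexI[of _ "\<lambda>x. c * g x"], rule bexI[of _ "\<lambda>x. c * h x"])
         (use * True in \<open>auto intro: polys_deg_le_cmult simp: algebra_simps\<close>)
  next
    case False
    then have "0 \<le> - c" by simp
    from convex_on_cmul[OF this *(4)] convex_on_cmul[OF this *(3)] show ?thesis
      unfolding convex_difference_def
      by (intro bexI[of _ "\<lambda>x. - c * h x"] bexI[of _ "\<lambda>x. - c * g x"] polys_deg_le_cmult *(1,2))
         (auto simp: *(5) algebra_simps)
  qed
qed

lemma convex_difference_sum:
  assumes "finite A" "\<And>a. a \<in> A \<Longrightarrow> convex_difference k (p a)"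
  shows "convex_difference k (\<lambda>x. \<Sum>a\<in>A. p a x)"
  using assms
proof (induction A rule: finite_induct)
  case empty
  show ?case
    unfolding convex_difference_def
    by (intro bexI[of _ "\<lambda>x. 0"]) (auto intro: polys_deg_le_const simp: convex_on_const)
qed (auto intro: convex_difference_add)

text \<open>A monomial of degree at most \<open>m\<close> is a product of exactly \<open>m\<close> affine forms, namely coordinates and
  constants \<open>1\<close>. Polarization turns it into a combination of \<open>m\<close>-th powers of affine forms, which are
  convex for even \<open>m\<close>.\<close>

lemma convex_difference_monomial:
  fixes \<alpha> :: "'n::finite \<Rightarrow> nat"
  assumes "even m" "(\<Sum>i\<in>UNIV. \<alpha> i) \<le> m"
  shows "convex_difference m (\<lambda>x :: real^'n. \<Prod>i\<in>UNIV. (x $ i) ^ \<alpha> i)"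
proof -
  \<comment> \<open>The factors are indexed by pairs: \<open>Some i\<close> stands for the coordinate \<open>i\<close> and \<open>None\<close> for the
     constant \<open>1\<close>, repeated as often as needed to reach \<open>m\<close> factors in total.\<close>
  define \<beta> where "\<beta> o' = (case o' of None \<Rightarrow> m - (\<Sum>i\<in>UNIV. \<alpha> i) | Some i \<Rightarrow> \<alpha> i)" for o'
  define A where "A = Sigma UNIV (\<lambda>o'. {..<\<beta> o'})"
  define y where "y x a = (case fst a of None \<Rightarrow> 1 | Some i \<Rightarrow> x $ i)" for x :: "real^'n" and a :: "'n option \<times> nat"
  have sum_option: "(\<Sum>o'\<in>UNIV. u o') = u None + (\<Sum>i\<in>UNIV. u (Some i))" for u :: "'n option \<Rightarrow> nat"
    by (simp add: UNIV_option_conv sum.reindex)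
  have prod_option: "(\<Prod>o'\<in>UNIV. u o') = u None * (\<Prod>i\<in>UNIV. u (Some i))" for u :: "'n option \<Rightarrow> real"
    by (simp add: UNIV_option_conv prod.reindex)
  have "finite A" by (simp add: A_def)
  have card: "card A = m"
    using assms(2) by (simp add: A_def sum_option \<beta>_def)
  have "(\<Prod>i\<in>UNIV. (x $ i) ^ \<alpha> i) = prod (y x) A" for x
  proof -
    have "prod (y x) A = (\<Prod>o'\<in>UNIV. \<Prod>j<\<beta> o'. y x (o', j))"
      unfolding A_def by (subst prod.Sigma) (auto simp: case_prod_unfold)
    then show ?thesis
      by (simp add: prod_option \<beta>_def y_def)
  qed
  also have "\<dots>x = (\<Sum>S\<in>Pow A. (-1) ^ card S * (-1) ^ card A / fact (card A) * (sum (y x) S) ^ m)" for x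
    using polarization[OF \<open>finite A\<close>, of "y x"] by (simp add: card)
  finally have eq: "(\<lambda>x :: real^'n. \<Prod>i\<in>UNIV. (x $ i) ^ \<alpha> i)
      = (\<lambda>x. \<Sum>S\<in>Pow A. (-1) ^ card S * (-1) ^ card A / fact (card A) * (sum (y x) S) ^ m)" by blast
  have y_affine: "affine_fun (\<lambda>x. y x a)" for a
  proof (cases "fst a")
    case None
    then show ?thesis by (simp add: y_def affine_fun_const)
  next
    case (Some i)
    have "linear (\<lambda>x :: real^'n. x $ i)" by (simp add: bounded_linear.linear bounded_linear_vec_nth)
    with Some show ?thesis
      unfolding affine_fun_alt y_def by (intro exI[of _ "\<lambda>x. x $ i"] exI[of _ 0]) simp
  qed
  have aff: "affine_fun (\<lambda>x. sum (y x) S)" if "finite S" for S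
    using that by (induction S rule: finite_induct) (auto intro: affine_fun_const affine_fun_add y_affine)
  have "convex_difference m (\<lambda>x. (sum (y x) S) ^ m)" if "S \<in> Pow A" for S
  proof -
    have "finite S" using that \<open>finite A\<close> finite_subset by blast
    show ?thesis
      unfolding convex_difference_def
      using polys_deg_le_power[OF affine_fun_in_polys[OF aff[OF \<open>finite S\<close>] order_refl], of m]
        convex_on_even_power_affine[OF aff[OF \<open>finite S\<close>] assms(1)]
      by (intro bexI[of _ "\<lambda>x. (sum (y x) S) ^ m"] bexI[of _ "\<lambda>x. 0"])
         (auto intro: polys_deg_le_const simp: convex_on_const)
  qed
  then show ?thesis
    unfolding eq using \<open>finite A\<close> by (intro convex_difference_sum convex_difference_cmult) auto
qed

lemma feasible_exists:
  assumes "f \<in> polys_deg_le (2 * d)"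
  shows "\<exists>g. feasible d f g"
proof -
  obtain c where f: "f = (\<lambda>x. \<Sum>\<alpha> | (\<Sum>i\<in>UNIV. \<alpha> i) \<le> 2 * d. c \<alpha> * (\<Prod>i\<in>UNIV. (x $ i) ^ \<alpha> i))"
    using assms unfolding polys_deg_le_def by blast
  have "convex_difference (2 * d) f"
    unfolding f
    by (intro convex_difference_sum convex_difference_cmult convex_difference_monomial
        finite_exponents) auto
  then show ?thesis
    unfolding convex_difference_def feasible_def by auto
qed

section \<open>Existence of an optimal decomposition\<close>

text \<open>A spanning subfamily of least cardinality is independent: from a nontrivial affine combination one
  member could be solved for and removed.\<close>

lemma ex_basis_modulo_affine:
  fixes m :: "'a \<Rightarrow> real^'n \<Rightarrow> real"
  assumes "finite A"
  shows "\<exists>B\<subseteq>A. (\<forall>c. \<exists>c'. affine_fun (\<lambda>x. (\<Sum>a\<in>A. c a * m a x) - (\<Sum>a\<in>B. c' a * m a x))) \<and>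
     (\<forall>c. affine_fun (\<lambda>x. \<Sum>a\<in>B. c a * m a x) \<longrightarrow> (\<forall>a\<in>B. c a = 0))"
proof -
  define spans where "spans B \<longleftrightarrow> B \<subseteq> A \<and>
    (\<forall>c. \<exists>c'. affine_fun (\<lambda>x. (\<Sum>a\<in>A. c a * m a x) - (\<Sum>a\<in>B. c' a * m a x)))" for B
  have "spans A"
    unfolding spans_def
  proof (intro conjI allI)
    show "\<exists>c'. affine_fun (\<lambda>x. (\<Sum>a\<in>A. c a * m a x) - (\<Sum>a\<in>A. c' a * m a x))" for c
      by (rule exI[of _ c]) (simp add: affine_fun_const)
  qed simp
  then obtain B where B: "spans B" and least: "\<And>B'. spans B' \<Longrightarrow> card B \<le> card B'"
    using ex_has_least_nat[of spans A card] by blast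
  have "finite B"
    using B assms finite_subset by (auto simp: spans_def)
  have "e b = 0" if e: "affine_fun (\<lambda>x. \<Sum>a\<in>B. e a * m a x)" and "b \<in> B" for e b
  proof (rule ccontr)
    assume "e b \<noteq> 0"
    have "spans (B - {b})"
      unfolding spans_def
    proof (intro conjI allI)
      show "B - {b} \<subseteq> A" using B by (auto simp: spans_def)
      fix c
      obtain c' where c': "affine_fun (\<lambda>x. (\<Sum>a\<in>A. c a * m a x) - (\<Sum>a\<in>B. c' a * m a x))"
        using B unfolding spans_def by blast
      \<comment> \<open>Subtracting this multiple of the affine combination kills the coefficient of \<open>b\<close>.\<close>
      define c'' where "c'' a = c' a - c' b / e b * e a" for a
      have "(\<Sum>a\<in>B. c'' a * m a x) = (\<Sum>a\<in>B - {b}. c'' a * m a x)" for x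
        using \<open>finite B\<close> \<open>b \<in> B\<close> \<open>e b \<noteq> 0\<close> by (simp add: sum.remove c''_def)
      moreover have "(\<Sum>a\<in>B. c'' a * m a x)
          = (\<Sum>a\<in>B. c' a * m a x) - c' b / e b * (\<Sum>a\<in>B. e a * m a x)" for x
        by (simp add: c''_def left_diff_distrib sum_subtractf sum_distrib_left mult.assoc)
      moreover have "affine_fun (\<lambda>x. ((\<Sum>a\<in>A. c a * m a x) - (\<Sum>a\<in>B. c' a * m a x))
          + c' b / e b * (\<Sum>a\<in>B. e a * m a x))"
        by (intro affine_fun_add affine_fun_cmult c' e)
      ultimately have "affine_fun (\<lambda>x. (\<Sum>a\<in>A. c a * m a x) - (\<Sum>a\<in>B - {b}. c'' a * m a x))"
        by (simp add: algebra_simps)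
      then show "\<exists>c'. affine_fun (\<lambda>x. (\<Sum>a\<in>A. c a * m a x) - (\<Sum>a\<in>B - {b}. c' a * m a x))"
        by blast
    qed
    from least[OF this] show False
      using \<open>finite B\<close> \<open>b \<in> B\<close> by (metis card_Diff1_less not_le)
  qed
  with B show ?thesis
    unfolding spans_def by blast
qed

text \<open>Tychonoff's theorem: coefficient vectors are functions with the product topology, so bounding
  each coefficient by itself gives a compact set.\<close>

lemma compact_coefficient_box:
  "compact {c :: 'a \<Rightarrow> real. (\<forall>a. a \<notin> B \<longrightarrow> c a = 0) \<and> (\<forall>a\<in>B. \<bar>c a\<bar> \<le> R)}"
proof -
  have "compactin (product_topology (\<lambda>_. euclidean) UNIV)
      (PiE UNIV (\<lambda>a :: 'a. if a \<in> B then {- R..R} else {0}))"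
    unfolding compactin_PiE by auto
  then have "compact (PiE UNIV (\<lambda>a :: 'a. if a \<in> B then {- R..R} else {0}))"
    by (simp add: euclidean_product_topology)
  also have "PiE UNIV (\<lambda>a :: 'a. if a \<in> B then {- R..R} else {0})
      = {c. (\<forall>a. a \<notin> B \<longrightarrow> c a = 0) \<and> (\<forall>a\<in>B. \<bar>c a\<bar> \<le> R)}"
    by (auto simp: PiE_def Pi_def abs_le_iff split: if_splits; smt (verit))
  finally show ?thesis .
qed

lemma closed_convex_coefficients:
  "closed {c :: 'a \<Rightarrow> real. convex_on UNIV (\<lambda>x. (\<Sum>a\<in>B. c a * m a x) - u x)}"
proof -
  have "{c :: 'a \<Rightarrow> real. convex_on UNIV (\<lambda>x. (\<Sum>a\<in>B. c a * m a x) - u x)}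
      = {c. \<forall>x y r s. 0 \<le> r \<and> 0 \<le> s \<and> r + s = 1 \<longrightarrow>
          (\<Sum>a\<in>B. c a * m a (r *\<^sub>R x + s *\<^sub>R y)) - u (r *\<^sub>R x + s *\<^sub>R y)
          \<le> r * ((\<Sum>a\<in>B. c a * m a x) - u x) + s * ((\<Sum>a\<in>B. c a * m a y) - u y)}"
    unfolding convex_on_def by auto
  also have "closed \<dots>"
    by (intro closed_Collect_all closed_Collect_imp open_Collect_const closed_Collect_le
        continuous_intros continuous_on_product_coordinates)
  finally show ?thesis .
qed

text \<open>Adding affine functions affects neither feasibility nor the objective, so the search for an
  optimum may be restricted to representatives modulo affine functions.\<close>

lemma feasible_cong_affine:
  assumes "feasible d f g" "affine_fun (\<lambda>x. g x - p x)" "p \<in> polys_deg_le (2 * d)"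
  shows "feasible d f p" "mean_trace_hessian p = mean_trace_hessian g"
proof -
  have aff: "affine_fun (\<lambda>x. p x - g x)"
    using affine_fun_cmult[OF assms(2), of "-1"] by simp
  have "convex_on UNIV (\<lambda>x. g x + (p x - g x))" "convex_on UNIV (\<lambda>x. (g x - f x) + (p x - g x))"
    using assms(1) convex_on_affine[OF aff] unfolding feasible_def by (intro convex_on_add; blast)+
  then show "feasible d f p"
    using assms(3) by (simp add: feasible_def)
  have "real_polynomial_function g" "real_polynomial_function p"
    using assms(1,3) real_polynomial_function_iff_polys_deg_le unfolding feasible_def by blast+
  then have "mean_trace_hessian (\<lambda>x. g x + (p x - g x)) = mean_trace_hessian g + mean_trace_hessian (\<lambda>x. p x - g x)"
    by (intro mean_trace_hessian_add) auto
  then show "mean_trace_hessian p = mean_trace_hessian g"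
    by (simp add: mean_trace_hessian_affine[OF aff])
qed

text \<open>Convex polynomials modulo affine functions form a closed cone in the space of coefficient vectors
  supported on \<open>B\<close>. By rigidity \<open>J\<close> is positive on its intersection with the unit sphere of the norm
  \<open>N\<close>, hence at least some \<open>\<epsilon> > 0\<close> there by compactness, and \<open>\<epsilon> * N c \<le> J c\<close> on the cone by
  homogeneity. A bound on \<open>J\<close> therefore bounds the coefficients.\<close>

lemma optimal_exists:
  fixes f :: "real^'n \<Rightarrow> real"
  assumes "f \<in> polys_deg_le (2 * d)" "CARD('n) \<ge> 2 \<or> d \<le> 2"
  shows "\<exists>g. is_arg_min mean_trace_hessian (feasible d f) g"
proof -
  define m where "m \<alpha> x = (\<Prod>i\<in>UNIV. (x $ i) ^ \<alpha> i)" for \<alpha> :: "'n \<Rightarrow> nat" and x :: "real^'n"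
  define A where "A = {\<alpha> :: 'n \<Rightarrow> nat. (\<Sum>i\<in>UNIV. \<alpha> i) \<le> 2 * d}"
  have "finite A"
    unfolding A_def by (rule finite_exponents)
  from ex_basis_modulo_affine[OF this, of m] obtain B where "B \<subseteq> A"
    and span: "\<forall>c. \<exists>c'. affine_fun (\<lambda>x. (\<Sum>\<alpha>\<in>A. c \<alpha> * m \<alpha> x) - (\<Sum>\<alpha>\<in>B. c' \<alpha> * m \<alpha> x))"
    and indep: "\<forall>c. affine_fun (\<lambda>x. \<Sum>\<alpha>\<in>B. c \<alpha> * m \<alpha> x) \<longrightarrow> (\<forall>\<alpha>\<in>B. c \<alpha> = 0)"
    by (elim exE conjE)
  have "finite B"
    using \<open>B \<subseteq> A\<close> \<open>finite A\<close> finite_subset by blast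
  define p where "p c x = (\<Sum>\<alpha>\<in>B. c \<alpha> * m \<alpha> x)" for c x
  define supported where "supported c \<longleftrightarrow> (\<forall>\<alpha>. \<alpha> \<notin> B \<longrightarrow> c \<alpha> = 0)" for c :: "('n \<Rightarrow> nat) \<Rightarrow> real"
  define N where "N c = (\<Sum>\<alpha>\<in>B. \<bar>c \<alpha>\<bar>)" for c :: "('n \<Rightarrow> nat) \<Rightarrow> real"
  define J where "J c = mean_trace_hessian (p c)" for c
  have m_poly: "m \<alpha> \<in> polys_deg_le (2 * d)" if "\<alpha> \<in> A" for \<alpha>
    using polys_deg_le_monomial[of \<alpha> "2 * d" 1] that by (simp add: A_def m_def[abs_def])
  have p_deg: "p c \<in> polys_deg_le (2 * d)" for c
    unfolding p_def[abs_def]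
    using \<open>B \<subseteq> A\<close> by (intro polys_deg_le_sum polys_deg_le_cmult m_poly \<open>finite B\<close>) auto
  have p_poly: "real_polynomial_function (p c)" for c
    using p_deg real_polynomial_function_iff_polys_deg_le by blast
  have J_sum: "J c = (\<Sum>\<alpha>\<in>B. c \<alpha> * mean_trace_hessian (m \<alpha>))" for c
    unfolding J_def p_def[abs_def]
    using m_poly \<open>B \<subseteq> A\<close> real_polynomial_function_iff_polys_deg_le
    by (intro mean_trace_hessian_sum \<open>finite B\<close>) blast
  have J_cont: "continuous_on S J" for S
    unfolding J_sum[abs_def]
    by (rule continuous_on_subset[of UNIV]) (intro continuous_intros continuous_on_product_coordinates, simp)
  have abs_le_N: "\<bar>c \<alpha>\<bar> \<le> N c" if "\<alpha> \<in> B" for c \<alpha>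
    unfolding N_def using \<open>finite B\<close> that by (intro member_le_sum) auto
  have box: "compact {c. supported c \<and> (\<forall>\<alpha>\<in>B. \<bar>c \<alpha>\<bar> \<le> R)}" for R
    unfolding supported_def by (rule compact_coefficient_box)
  have closed_convex: "closed {c. convex_on UNIV (\<lambda>x. p c x - u x)}" for u
    unfolding p_def by (rule closed_convex_coefficients)

  have "\<exists>\<epsilon>>0. \<forall>c. supported c \<longrightarrow> convex_on UNIV (p c) \<longrightarrow> N c = 1 \<longrightarrow> \<epsilon> \<le> J c"
  proof -
    define S where "S = {c. supported c \<and> (\<forall>\<alpha>\<in>B. \<bar>c \<alpha>\<bar> \<le> 1)} \<inter>
      ({c. convex_on UNIV (\<lambda>x. p c x - 0)} \<inter> {c. N c = 1})"
    have "closed {c. N c = 1}"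
      unfolding N_def
      by (intro closed_Collect_eq continuous_intros continuous_on_product_coordinates)
    then have "compact S"
      unfolding S_def by (intro compact_Int_closed box closed_Int closed_convex)
    have pos: "0 < J c" if "c \<in> S" for c
    proof -
      have c: "convex_on UNIV (p c)" "N c = 1"
        using that by (auto simp: S_def)
      have "J c \<noteq> 0"
      proof
        assume "J c = 0"
        then have "affine_fun (p c)"
          using affine_if_mean_trace_hessian_eq_0[OF p_deg assms(2) c(1)] by (simp add: J_def)
        then have "N c = 0"
          using indep[rule_format, of c] by (simp add: N_def p_def[abs_def])
        with c(2) show False by simp
      qed
      moreover have "0 \<le> J c"
        unfolding J_def by (rule mean_trace_hessian_nonneg[OF c(1) p_poly])
      ultimately show ?thesis by simp
    qed
    have in_S: "c \<in> S" if "supported c" "convex_on UNIV (p c)" "N c = 1" for c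
      using that abs_le_N[of _ c] by (auto simp: S_def)
    show ?thesis
    proof (cases "S = {}")
      case True
      then show ?thesis using in_S by (intro exI[of _ 1]) auto
    next
      case False
      from continuous_attains_inf[OF \<open>compact S\<close> this J_cont] obtain c where "c \<in> S" "\<forall>e\<in>S. J c \<le> J e"
        by blast
      with pos in_S show ?thesis by blast
    qed
  qed
  then obtain \<epsilon> where "\<epsilon> > 0" and
    \<epsilon>: "\<And>c. supported c \<Longrightarrow> convex_on UNIV (p c) \<Longrightarrow> N c = 1 \<Longrightarrow> \<epsilon> \<le> J c"
    by blast
  have coercive: "\<epsilon> * N c \<le> J c" if c: "supported c" "convex_on UNIV (p c)" for c
  proof (cases "N c = 0")
    case True
    then show ?thesis
      using mean_trace_hessian_nonneg[OF c(2) p_poly] by (simp add: J_def)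
  next
    case False
    then have "0 < N c"
      by (simp add: N_def sum_nonneg order_less_le)
    define e where "e \<alpha> = c \<alpha> / N c" for \<alpha>
    have "p e = (\<lambda>x. 1 / N c * p c x)"
      by (simp add: p_def fun_eq_iff e_def sum_distrib_left)
    with c(2) \<open>0 < N c\<close> have "convex_on UNIV (p e)"
      by (simp only:) (intro convex_on_cmul, auto)
    moreover have "N e = 1"
      using \<open>0 < N c\<close> by (simp add: N_def[of e] e_def abs_divide flip: sum_divide_distrib) (simp add: N_def)
    ultimately have "\<epsilon> \<le> J e"
      using c(1) by (intro \<epsilon>) (auto simp: supported_def e_def)
    moreover have "J e = J c / N c"
      by (simp add: J_sum e_def sum_divide_distrib)
    ultimately show ?thesis
      using \<open>0 < N c\<close> by (simp add: pos_le_divide_eq)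
  qed

  have represent: "\<exists>c. supported c \<and> feasible d f (p c) \<and> J c = mean_trace_hessian g"
    if feas: "feasible d f g" for g
  proof -
    obtain b where "g = (\<lambda>x. \<Sum>\<alpha>\<in>A. b \<alpha> * m \<alpha> x)"
      using feas unfolding feasible_def polys_deg_le_def A_def m_def by blast
    then obtain c' where c': "affine_fun (\<lambda>x. g x - p c' x)"
      using span[rule_format, of b] by (auto simp: p_def)
    define c where "c \<alpha> = (if \<alpha> \<in> B then c' \<alpha> else 0)" for \<alpha>
    have "p c = p c'"
      by (simp add: p_def c_def fun_eq_iff)
    then have "supported c" "affine_fun (\<lambda>x. g x - p c x)"
      using c' by (simp_all add: supported_def c_def)
    with feasible_cong_affine[OF feas this(2) p_deg] show ?thesis
      by (auto simp: J_def)
  qed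
  obtain g0 where "feasible d f g0"
    using feasible_exists[OF assms(1)] by blast
  then obtain c0 where c0: "supported c0" "feasible d f (p c0)"
    using represent by blast
  \<comment> \<open>By coercivity this box contains every feasible vector that does at least as well as \<open>c0\<close>.\<close>
  define S where "S = {c. supported c \<and> (\<forall>\<alpha>\<in>B. \<bar>c \<alpha>\<bar> \<le> J c0 / \<epsilon>)} \<inter>
    ({c. convex_on UNIV (\<lambda>x. p c x - 0)} \<inter> {c. convex_on UNIV (\<lambda>x. p c x - f x)})"
  have "compact S"
    unfolding S_def by (intro compact_Int_closed box closed_Int closed_convex)
  have in_S: "c \<in> S" if "supported c" "feasible d f (p c)" "J c \<le> J c0" for c
  proof -
    have "\<epsilon> * N c \<le> J c0"
      using coercive[of c] that by (auto simp: feasible_def)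
    then have "N c \<le> J c0 / \<epsilon>"
      using \<open>\<epsilon> > 0\<close> by (simp add: pos_le_divide_eq mult.commute)
    then show ?thesis
      using that abs_le_N[of _ c] by (fastforce simp: S_def feasible_def)
  qed
  have "c0 \<in> S"
    by (rule in_S[OF c0]) simp
  with continuous_attains_inf[OF \<open>compact S\<close> _ J_cont] obtain c
    where c: "c \<in> S" "\<And>e. e \<in> S \<Longrightarrow> J c \<le> J e"
    by blast
  have "feasible d f (p c)"
    using c(1) p_deg by (simp add: S_def feasible_def)
  moreover have "mean_trace_hessian (p c) \<le> mean_trace_hessian g" if feas: "feasible d f g" for g
  proof -
    obtain e where e: "supported e" "feasible d f (p e)" "J e = mean_trace_hessian g"
      using represent[OF feas] by blast
    have "J c \<le> J e"
      using c(2)[OF \<open>c0 \<in> S\<close>] c(2)[OF in_S[OF e(1,2)]] by linarith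
    with e(3) show ?thesis by (simp add: J_def)
  qed
  ultimately show ?thesis
    unfolding is_arg_min_def by (metis not_less)
qed

section \<open>Optimal decompositions are undominated\<close>

text \<open>The terms of degree at most \<open>k\<close> are \<open>O(t ^ k)\<close>, so the remaining ones are too. Divided by
  \<open>t ^ k\<close> they form a polynomial that is bounded for \<open>t \<ge> 1\<close>, whereas a nonconstant
  polynomial is unbounded there.\<close>

lemma coefficient_eq_0_if_bounded:
  fixes a :: "nat \<Rightarrow> real"
  assumes bound: "\<And>t. 1 \<le> t \<Longrightarrow> \<bar>\<Sum>j\<le>N. a j * t ^ j\<bar> \<le> C * t ^ k" and "k < j" "j \<le> N"
  shows "a j = 0"
proof (rule ccontr)
  assume "a j \<noteq> 0"
  \<comment> \<open>The terms of degree above \<open>k\<close>, divided by \<open>t ^ k\<close>; the constant term is zero because \<open>a k\<close>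
     belongs to the low part.\<close>
  define q where "q i = (if i = 0 then 0 else a (k + i))" for i
  define B where "B = C + (\<Sum>j\<le>k. \<bar>a j\<bar>)"
  have bounded: "\<bar>\<Sum>i\<le>N - k. q i * t ^ i\<bar> \<le> B" if "1 \<le> t" for t
  proof -
    have "(\<Sum>j\<le>N. a j * t ^ j) = (\<Sum>j\<le>k. a j * t ^ j) + (\<Sum>j\<in>{k<..N}. a j * t ^ j)"
      using assms(2,3) by (subst sum.union_disjoint[symmetric]) (auto intro!: sum.cong)
    also have "(\<Sum>j\<in>{k<..N}. a j * t ^ j) = (\<Sum>i\<in>{0<..N - k}. t ^ k * (q i * t ^ i))"
      by (rule sum.reindex_bij_witness[of _ "\<lambda>i. k + i" "\<lambda>j. j - k"])
         (auto simp: q_def simp flip: power_add)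
    also have "\<dots> = (\<Sum>i\<le>N - k. t ^ k * (q i * t ^ i))"
      by (rule sum.mono_neutral_left) (auto simp: q_def)
    finally have split: "t ^ k * (\<Sum>i\<le>N - k. q i * t ^ i) = (\<Sum>j\<le>N. a j * t ^ j) - (\<Sum>j\<le>k. a j * t ^ j)"
      by (simp add: sum_distrib_left)
    have "t ^ k * \<bar>\<Sum>i\<le>N - k. q i * t ^ i\<bar> = \<bar>(\<Sum>j\<le>N. a j * t ^ j) - (\<Sum>j\<le>k. a j * t ^ j)\<bar>"
      unfolding split[symmetric] abs_mult using that by simp
    also have "\<dots> \<le> C * t ^ k + (\<Sum>j\<le>k. \<bar>a j * t ^ j\<bar>)"
      using bound[OF that] sum_abs[of "\<lambda>j. a j * t ^ j" "{..k}"] by linarith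
    also have "(\<Sum>j\<le>k. \<bar>a j * t ^ j\<bar>) \<le> (\<Sum>j\<le>k. \<bar>a j\<bar> * t ^ k)"
      using that by (intro sum_mono) (auto simp: abs_mult power_increasing intro!: mult_left_mono)
    finally have "t ^ k * \<bar>\<Sum>i\<le>N - k. q i * t ^ i\<bar> \<le> t ^ k * B"
      by (simp add: B_def algebra_simps sum_distrib_left)
    then show ?thesis
      using that by (simp add: mult_le_cancel_left_pos)
  qed
  have "eventually (\<lambda>t. norm (\<Sum>i\<le>N - k. q i * t ^ i) \<ge> B + 1) at_infinity"
    using Limits.polyfun_extremal[where c = q and k = "j - k" and n = "N - k" and B = "B + 1"]
      \<open>a j \<noteq> 0\<close> assms(2,3) by (simp add: q_def)
  then obtain b where large: "\<forall>t. b \<le> norm t \<longrightarrow> B + 1 \<le> norm (\<Sum>i\<le>N - k. q i * t ^ i)"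
    unfolding eventually_at_infinity ..
  have "B + 1 \<le> norm (\<Sum>i\<le>N - k. q i * max 1 b ^ i)"
    by (rule large[rule_format]) simp
  with bounded[of "max 1 b"] show False
    by simp
qed

lemma polys_deg_le_if_bounded_on_rays:
  fixes g :: "real^'n \<Rightarrow> real"
  assumes "real_polynomial_function g"
    and bound: "\<And>v. \<exists>C. \<forall>t\<ge>1. \<bar>g (t *\<^sub>R v)\<bar> \<le> C * t ^ k"
  shows "g \<in> polys_deg_le k"
proof -
  obtain N where "g \<in> polys_deg_le N"
    using assms(1) real_polynomial_function_iff_polys_deg_le by blast
  from homogeneous_decomposition[OF this] obtain h where
    "\<forall>j. h j \<in> polys_deg_le j" "\<forall>t v. g (t *\<^sub>R v) = (\<Sum>j\<le>N. h j v * t ^ j)"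
    by (elim exE conjE)
  note h = this[rule_format]
  have high: "h j v = 0" if j: "k < j" "j \<le> N" for j v
  proof -
    obtain C where "\<forall>t\<ge>1. \<bar>g (t *\<^sub>R v)\<bar> \<le> C * t ^ k"
      using bound by blast
    then show ?thesis
      using coefficient_eq_0_if_bounded[where N = N and a = "\<lambda>j. h j v" and C = C and k = k and j = j] j by (simp add: h(2))
  qed
  have "g v = (\<Sum>j\<le>min k N. h j v)" for v
  proof -
    have "g v = (\<Sum>j\<le>N. h j v)"
      using h(2)[of 1 v] by simp
    also have "\<dots> = (\<Sum>j\<le>min k N. h j v)"
      by (rule sum.mono_neutral_right) (auto, meson high not_le)
    finally show ?thesis .
  qed
  then have "g = (\<lambda>v. \<Sum>j\<le>min k N. h j v)" by blast
  also have "\<dots> \<in> polys_deg_le k"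
    by (intro polys_deg_le_sum polys_deg_le_mono[OF h(1)]) auto
  finally show ?thesis .
qed

lemma abs_linear_le_power:
  fixes t :: real
  assumes "1 \<le> t" "1 \<le> k"
  shows "\<bar>a + t * b\<bar> \<le> (\<bar>a\<bar> + \<bar>b\<bar>) * t ^ k"
proof -
  have "t \<le> t ^ k" using power_increasing[OF assms(2,1)] by simp
  then have "t * \<bar>b\<bar> \<le> t ^ k * \<bar>b\<bar>" "1 * \<bar>a\<bar> \<le> t ^ k * \<bar>a\<bar>"
    using assms by (intro mult_right_mono; simp)+
  moreover have "\<bar>a + t * b\<bar> \<le> \<bar>a\<bar> + t * \<bar>b\<bar>"
    using assms abs_triangle_ineq[of a "t * b"] by (simp add: abs_mult)
  ultimately show ?thesis by (simp add: algebra_simps)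
qed

text \<open>The convex functions \<open>g'\<close> and \<open>h = g - g'\<close> are bounded below by their tangents at \<open>0\<close>. As
  \<open>g' = g - h\<close>, this bounds \<open>g'\<close> from both sides by \<open>O(t ^ k)\<close> along each ray.\<close>

lemma polys_deg_le_if_convex_summand:
  fixes g g' :: "real^'n \<Rightarrow> real"
  assumes "1 \<le> k" "g \<in> polys_deg_le k"
    and g': "real_polynomial_function g'" "convex_on UNIV g'" "convex_on UNIV (\<lambda>x. g x - g' x)"
  shows "g' \<in> polys_deg_le k"
proof (rule polys_deg_le_if_bounded_on_rays[OF g'(1)])
  fix v :: "real^'n"
  define h where "h x = g x - g' x" for x
  have "real_polynomial_function g"
    using assms(2) real_polynomial_function_iff_polys_deg_le by blast
  then have h: "real_polynomial_function h" "convex_on UNIV h"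
    unfolding h_def[abs_def] using g' by auto
  have minorant: "p 0 + t * dir_deriv v p 0 \<le> p (t *\<^sub>R v)"
    if "real_polynomial_function p" "convex_on UNIV p" for p t
    using convex_above_tangent[OF that(2,1), of 0 "t *\<^sub>R v"] by (simp add: dir_deriv_scaleR[OF that(1)])
  from polys_deg_le_along_line[OF assms(2), of v] obtain a where
    "\<forall>t. g (t *\<^sub>R v) = (\<Sum>j\<le>k. a j * t ^ j)" ..
  note a = this[rule_format]
  define C where "C = (\<bar>g' 0\<bar> + \<bar>dir_deriv v g' 0\<bar>) + (\<bar>h 0\<bar> + \<bar>dir_deriv v h 0\<bar>) + (\<Sum>j\<le>k. \<bar>a j\<bar>)"
  have "\<bar>g' (t *\<^sub>R v)\<bar> \<le> C * t ^ k" if "1 \<le> t" for t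
  proof -
    have "\<bar>g (t *\<^sub>R v)\<bar> \<le> (\<Sum>j\<le>k. \<bar>a j * t ^ j\<bar>)"
      unfolding a by (rule sum_abs)
    also have "\<dots> \<le> (\<Sum>j\<le>k. \<bar>a j\<bar> * t ^ k)"
      using that by (intro sum_mono) (auto simp: abs_mult power_increasing intro!: mult_left_mono)
    finally have g: "\<bar>g (t *\<^sub>R v)\<bar> \<le> (\<Sum>j\<le>k. \<bar>a j\<bar>) * t ^ k"
      by (simp add: sum_distrib_right)
    define P where "P = (\<bar>g' 0\<bar> + \<bar>dir_deriv v g' 0\<bar>) * t ^ k"
    define Q where "Q = (\<bar>h 0\<bar> + \<bar>dir_deriv v h 0\<bar>) * t ^ k"
    have "- P \<le> g' (t *\<^sub>R v)"
      using minorant[OF g'(1,2), of t] abs_linear_le_power[OF that assms(1), of "g' 0" "dir_deriv v g' 0"]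
      unfolding P_def by linarith
    moreover have "- Q \<le> h (t *\<^sub>R v)"
      using minorant[OF h, of t] abs_linear_le_power[OF that assms(1), of "h 0" "dir_deriv v h 0"]
      unfolding Q_def by linarith
    moreover have "0 \<le> P" "0 \<le> Q"
      using that by (auto simp: P_def Q_def)
    moreover have "C * t ^ k = P + Q + (\<Sum>j\<le>k. \<bar>a j\<bar>) * t ^ k"
      by (simp add: C_def P_def Q_def algebra_simps)
    ultimately show ?thesis
      using g unfolding h_def by linarith
  qed
  then show "\<exists>C. \<forall>t\<ge>1. \<bar>g' (t *\<^sub>R v)\<bar> \<le> C * t ^ k" by blast
qed

lemma undominated_if_optimal:
  fixes f g :: "real^'n \<Rightarrow> real"
  assumes "d \<ge> 1" "CARD('n) \<ge> 2 \<or> d \<le> 2"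
    and opt: "is_arg_min mean_trace_hessian (feasible d f) g"
  shows "undominated_dcd f g"
proof -
  have feas: "feasible d f g" and opt: "\<And>y. feasible d f y \<Longrightarrow> mean_trace_hessian g \<le> mean_trace_hessian y"
    using opt unfolding is_arg_min_def by (auto simp: not_less)
  have g: "g \<in> polys_deg_le (2 * d)" "convex_on UNIV g" "convex_on UNIV (\<lambda>x. g x - f x)"
    using feas by (auto simp: feasible_def)
  then have poly_g: "real_polynomial_function g"
    using real_polynomial_function_iff_polys_deg_le by blast
  have "\<not> dominates f g' g" for g'
  proof
    assume "dominates f g' g"
    then have g': "real_polynomial_function g'" "convex_on UNIV g'" "convex_on UNIV (\<lambda>x. g' x - f x)"
      "convex_on UNIV (\<lambda>x. g x - g' x)" "\<not> affine_fun (\<lambda>x. g x - g' x)"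
      by (auto simp: dominates_def dcd_def)
    have deg: "g' \<in> polys_deg_le (2 * d)"
      using assms(1) by (intro polys_deg_le_if_convex_summand[OF _ g(1) g'(1,2,4)]) simp
    have "mean_trace_hessian g \<le> mean_trace_hessian g'"
      using deg g' by (intro opt) (simp add: feasible_def)
    moreover have "0 \<le> mean_trace_hessian (\<lambda>x. g x - g' x)"
      using g'(1,4) poly_g by (intro mean_trace_hessian_nonneg) auto
    ultimately have "mean_trace_hessian (\<lambda>x. g x - g' x) = 0"
      by (simp add: mean_trace_hessian_diff poly_g g'(1))
    from affine_if_mean_trace_hessian_eq_0[OF polys_deg_le_diff[OF g(1) deg] assms(2) g'(4) this] g'(5)
    show False by blast
  qed
  then show ?thesis
    unfolding undominated_dcd_def dcd_def using poly_g g by blast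
qed

theorem theorem5p2p6:
  fixes f :: "real^'n \<Rightarrow> real" and d :: nat
  assumes "d \<ge> 1"
    and "f \<in> polys_deg_le (2 * d)"
    and "CARD('n) \<ge> 2 \<or> d \<le> 2"
  shows "(\<exists>g. is_arg_min mean_trace_hessian (feasible d f) g) \<and>
         (\<forall>g. is_arg_min mean_trace_hessian (feasible d f) g \<longrightarrow> undominated_dcd f g)"
  using optimal_exists[OF assms(2,3)] undominated_if_optimal[OF assms(1,3)] by blast

end
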